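(* Let $\beta>0$ and let $V,W\colon\mathbb T^d\to\mathbb R$ satisfy: (i) $V,W\in\mathcal C^2(\mathbb T^d)$; (ii) $W$ is even; (iii) $W$ is either $H$-stable (i.e. it has nonnegative Fourier modes) or satisfies $\|W\|_{L^\infty(\mathbb T^d)}<\beta^{-1}$. Let $f_t$ be the solution of the McKean–Vlasov PDE on $\mathbb T^d$ with initial probability density $f_0$, and $f_\infty$ the unique invariant density. Then for all $t\ge0$ $$\|f_t-f_\infty\|_{L^2(\mathbb T^d)}\le\|f_0-f_\infty\|_{L^2(\mathbb T^d)}e^{-\zeta t},$$ where $$\zeta=\frac{\pi^2}{4\beta}-\beta\left(\|\nabla V\|_{L^\infty(\mathbb T^d)}+(1+\Gamma)\|\nabla W\|_{L^\infty(\mathbb T^d)}\right)^2,\qquad\Gamma=e^{2\beta\left(\|V\|_{L^\infty(\mathbb T^d)}+\|W\|_{L^\infty(\mathbb T^d)}\right)}.$$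
   Context: $\mathbb T^d$ is the $d$-dimensional torus of side length $1$. The McKean–Vlasov PDE is $\partial_tf_t=\nabla\cdot(\nabla Vf_t+(\nabla W*f_t)f_t)+\beta^{-1}\Delta f_t$. Under the stated hypotheses it has a unique stationary probability density $f_\infty$, which is the unique probability density on $\mathbb T^d$ solving $f_\infty=\frac1Ze^{-\beta(V+W*f_\infty)}$, $Z=\int_{\mathbb T^d}e^{-\beta(V+W*f_\infty)}$. *)

theory Defs
  imports "HOL-Analysis.Analysis" "HOL-Probability.Essential_Supremum"
begin

text \<open>
  Functions on the torus of side length 1 are functions on \<^typ>\<open>real^'n\<close> that are 1-periodic in
  every coordinate; integration over the torus is integration over the unit cube.
\<close>

definition periodic :: "(real^'n \<Rightarrow> 'b) \<Rightarrow> bool" where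
  "periodic u \<longleftrightarrow> (\<forall>x i. u (x + axis i 1) = u x)"

definition torus :: "(real^'n) measure" where
  "torus = restrict_space lborel (cbox 0 One)"

definition grad :: "(real^'n \<Rightarrow> real) \<Rightarrow> real^'n \<Rightarrow> real^'n" where
  "grad u x = (\<chi> i. frechet_derivative u (at x) (axis i 1))"

definition hessian :: "(real^'n \<Rightarrow> real) \<Rightarrow> real^'n \<Rightarrow> real^'n^'n" where
  "hessian u x = matrix (frechet_derivative (grad u) (at x))"

definition divergence :: "(real^'n \<Rightarrow> real^'n) \<Rightarrow> real^'n \<Rightarrow> real" where
  "divergence F x = trace (matrix (frechet_derivative F (at x)))"

definition laplacian :: "(real^'n \<Rightarrow> real) \<Rightarrow> real^'n \<Rightarrow> real" where
  "laplacian u = divergence (grad u)"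

definition C2_torus :: "(real^'n \<Rightarrow> real) \<Rightarrow> bool" where
  "C2_torus u \<longleftrightarrow> periodic u \<and> (\<forall>x. u differentiable (at x)) \<and>
     (\<forall>x. grad u differentiable (at x)) \<and> continuous_on UNIV (hessian u)"

text \<open>
  The essential supremum lives in the extended reals; the conversion to a real is only meaningful
  for essentially bounded functions, such as continuous ones.
\<close>

definition Linf_norm :: "(real^'n \<Rightarrow> 'b::real_normed_vector) \<Rightarrow> real" where
  "Linf_norm u = real_of_ereal (esssup torus (\<lambda>x. ereal (norm (u x))))"

text \<open>The value is infinite exactly when the function is not square integrable.\<close>

definition L2_norm :: "(real^'n \<Rightarrow> real) \<Rightarrow> ennreal" where
  "L2_norm u = (let I = (\<integral>\<^sup>+ x. ennreal ((u x)\<^sup>2) \<partial>torus) in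
     if I = \<infinity> then \<infinity> else ennreal (sqrt (enn2real I)))"

definition L1_norm :: "(real^'n \<Rightarrow> real) \<Rightarrow> ennreal" where
  "L1_norm u = (\<integral>\<^sup>+ x. ennreal \<bar>u x\<bar> \<partial>torus)"

definition conv :: "(real^'n \<Rightarrow> 'b::euclidean_space) \<Rightarrow> (real^'n \<Rightarrow> real) \<Rightarrow> real^'n \<Rightarrow> 'b" where
  "conv K u x = (LINT y|torus. u y *\<^sub>R K (x - y))"

definition fourier_mode :: "(real^'n \<Rightarrow> real) \<Rightarrow> int^'n \<Rightarrow> complex" where
  "fourier_mode u k =
     (LINT x|torus. complex_of_real (u x) * cis (- 2 * pi * (\<Sum>i\<in>UNIV. of_int (k $ i) * x $ i)))"

definition H_stable :: "(real^'n \<Rightarrow> real) \<Rightarrow> bool" where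
  "H_stable u \<longleftrightarrow> (\<forall>k. fourier_mode u k \<in> \<real>\<^sub>\<ge>\<^sub>0)"

definition prob_density :: "(real^'n \<Rightarrow> real) \<Rightarrow> bool" where
  "prob_density p \<longleftrightarrow> periodic p \<and> p \<in> borel_measurable borel \<and> (\<forall>x. 0 \<le> p x) \<and>
     (\<integral>\<^sup>+ x. ennreal (p x) \<partial>torus) = 1"

definition MV_rhs ::
  "real \<Rightarrow> (real^'n \<Rightarrow> real) \<Rightarrow> (real^'n \<Rightarrow> real) \<Rightarrow> (real^'n \<Rightarrow> real) \<Rightarrow> real^'n \<Rightarrow> real" where
  "MV_rhs \<beta> V W p x =
     divergence (\<lambda>y. p y *\<^sub>R grad V y + p y *\<^sub>R conv (grad W) p y) x + (1 / \<beta>) * laplacian p x"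

text \<open>
  Classical solutions within the probability densities: the equation holds pointwise for positive
  times, with \<open>f t\<close> twice continuously differentiable in space and the time derivative jointly
  continuous. The initial density need not be smooth: it is attained in \<open>L\<^sup>1\<close>, and in \<open>L\<^sup>2\<close> if it
  is square integrable.
\<close>

definition MV_solution ::
  "real \<Rightarrow> (real^'n \<Rightarrow> real) \<Rightarrow> (real^'n \<Rightarrow> real) \<Rightarrow> (real^'n \<Rightarrow> real) \<Rightarrow>
   (real \<Rightarrow> real^'n \<Rightarrow> real) \<Rightarrow> bool" where
  "MV_solution \<beta> V W f0 f \<longleftrightarrow>
     f 0 = f0 \<and>
     (\<forall>t\<ge>0. prob_density (f t)) \<and>
     (\<forall>t>0. C2_torus (f t)) \<and>
     (\<forall>t>0. \<forall>x. ((\<lambda>s. f s x) has_real_derivative MV_rhs \<beta> V W (f t) x) (at t)) \<and>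
     continuous_on ({0<..} \<times> UNIV) (\<lambda>(t, x). deriv (\<lambda>s. f s x) t) \<and>
     ((\<lambda>t. L1_norm (\<lambda>x. f t x - f0 x)) \<longlongrightarrow> 0) (at_right 0) \<and>
     (L2_norm f0 < \<infinity> \<longrightarrow> ((\<lambda>t. L2_norm (\<lambda>x. f t x - f0 x)) \<longlongrightarrow> 0) (at_right 0))"

definition invariant_density ::
  "real \<Rightarrow> (real^'n \<Rightarrow> real) \<Rightarrow> (real^'n \<Rightarrow> real) \<Rightarrow> (real^'n \<Rightarrow> real) \<Rightarrow> bool" where
  "invariant_density \<beta> V W p \<longleftrightarrow> MV_solution \<beta> V W p (\<lambda>t. p)"

definition Gamma_const :: "real \<Rightarrow> (real^'n \<Rightarrow> real) \<Rightarrow> (real^'n \<Rightarrow> real) \<Rightarrow> real" where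
  "Gamma_const \<beta> V W = exp (2 * \<beta> * (Linf_norm V + Linf_norm W))"

definition zeta_rate :: "real \<Rightarrow> (real^'n \<Rightarrow> real) \<Rightarrow> (real^'n \<Rightarrow> real) \<Rightarrow> real" where
  "zeta_rate \<beta> V W = pi\<^sup>2 / (4 * \<beta>) -
     \<beta> * (Linf_norm (grad V) + (1 + Gamma_const \<beta> V W) * Linf_norm (grad W))\<^sup>2"

end

theory Submission
  imports Defs
begin

text \<open>
  Put \<open>h = f t - f_inf\<close> and test the equation for \<open>h\<close> against \<open>h\<close>. Integration by parts
  leaves the dissipation \<open>(1/\<beta>) \<integral> |grad h|^2\<close> and drift terms which, by \<open>f_inf \<le> \<Gamma>\<close> and
  \<open>\<integral> |h| \<le> (\<integral> h^2)^(1/2)\<close>, are bounded by \<open>C (\<integral> h^2)^(1/2) (\<integral> |grad h|^2)^(1/2)\<close> with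
  \<open>C = |grad V| + (1 + \<Gamma>) |grad W|\<close>. Young's inequality spends half of the dissipation on them,
  and the rest is bounded below by the Poincare inequality on mean-zero functions, for which the
  crude constant 8 is enough because \<open>8 \<ge> \<pi>^2/2\<close>. Gronwall's inequality gives the decay between
  positive times, and the \<open>L^2\<close> continuity at time 0 extends it to \<open>f0\<close>.
\<close>

subsection \<open>Periodic functions\<close>

text \<open>The obstacle is the quadratic drift, as no uniform bound on \<open>f t\<close> is at
  hand. The difference of the two interaction fluxes is therefore written as h (grad W * f_t) +
  f_inf (grad W * h): then \<open>f t\<close> enters only through its unit mass, and only
  \<open>f_inf\<close> has to be bounded pointwise. The two summands account for the 1 and the
  \<Gamma> in the factor 1 + \<Gamma>. The bound on \<open>f_inf\<close> has to be derived too,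
  because \<open>invariant_density\<close> only says that a constant path solves the equation; its
  Gibbs form is recovered from that. In the Poincare inequality an average over translations takes
  the place of Fourier series. The resulting constant is far from the sharp 4 \<pi>^2, but \<zeta>
  asks for little.\<close>

abbreviation cube :: "(real^'n) set" where "cube \<equiv> cbox 0 One"

text \<open>\<open>One\<close> abbreviates the sum of all basis vectors. As a simp rule this
  evaluates its coordinates, so that membership in boxes with corner \<open>One\<close> reduces to
  coordinatewise inequalities.\<close>

lemma sum_Basis_nth [simp]: "(\<Sum>b\<in>Basis. (b :: real^'n) $ i) = 1"
proof -
  have "(\<Sum>b\<in>Basis. (b :: real^'n) $ i) = (\<Sum>b\<in>Basis. b \<bullet> (axis i 1 :: real^'n))"
    by (simp add: inner_axis)
  also have "\<dots> = (\<Sum>b\<in>Basis. if b = (axis i 1 :: real^'n) then 1 else 0)"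
    by (intro sum.cong refl) (simp add: inner_Basis axis_in_Basis_iff)
  also have "\<dots> = 1" by (simp add: axis_in_Basis_iff)
  finally show ?thesis .
qed

lemma cube_iff: "x \<in> cube \<longleftrightarrow> (\<forall>i. 0 \<le> x $ i \<and> x $ i \<le> 1)"
  by (simp add: mem_box_cart)

lemma vec_sum_axis: "(\<Sum>i\<in>UNIV. axis i (x $ i)) = (x :: real^'n)"
  by (simp add: vec_eq_iff axis_def if_distrib sum.If_cases cong: if_cong)

lemma axis_add: "axis i (a + b) = axis i a + (axis i b :: real^'n)"
  by (simp add: vec_eq_iff axis_def)

lemma scaleR_axis: "c *\<^sub>R axis i 1 = (axis i c :: real^'n)"
  by (simp add: vec_eq_iff axis_def)

text \<open>Reduces a claim about a translation vector to translations along single axes. There is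
  no case for 0: the index type is nonempty, so the empty sum never has to be covered. The axis case
  speaks only of the components of \<open>a\<close>, so facts about these (such as integrality)
  remain available.\<close>

lemma vec_axis_induct [case_names add axis]:
  fixes a :: "real^'n"
  assumes "\<And>x y. P x \<Longrightarrow> P y \<Longrightarrow> P (x + y)" "\<And>i. P (axis i (a $ i))"
  shows "P a"
proof -
  have "S \<noteq> {} \<longrightarrow> P (\<Sum>i\<in>S. axis i (a $ i))" if "finite S" for S :: "'n set"
    using that
  proof induction
    case (insert i S)
    then show ?case using assms by (cases "S = {}") auto
  qed simp
  from this[of UNIV] show ?thesis by (simp add: vec_sum_axis)
qed

lemma periodic_shift_int:
  assumes "periodic u"
  shows "u (x + axis i (of_int k)) = u x"
proof -
  have step: "u (y + axis i 1) = u y" for y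
    using assms by (simp add: periodic_def)
  show ?thesis
  proof (induction k arbitrary: x rule: int_induct[where k = 0])
    case base
    show ?case by (simp add: axis_def zero_vec_def[symmetric])
  next
    case (step1 k)
    then show ?case using step[of "x + axis i (of_int k)"] by (simp add: axis_add add.assoc)
  next
    case (step2 k)
    have "x + axis i (of_int k) = x + axis i (of_int (k - 1)) + axis i 1"
      by (simp add: vec_eq_iff axis_def)
    then show ?case using step2 step[of "x + axis i (of_int (k - 1))"] by metis
  qed
qed

lemma periodic_shift_lattice:
  fixes k :: "real^'n"
  assumes "periodic u" "\<And>i. k $ i \<in> \<int>"
  shows "u (x + k) = u x"
proof -
  have "\<forall>x. u (x + k) = u x"
  proof (induction k rule: vec_axis_induct)
    case (axis i)
    obtain m where "k $ i = of_int m" using assms(2) Ints_cases by blast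
    then show ?case using periodic_shift_int[OF assms(1)] by auto
  qed (metis add.assoc)
  then show ?thesis by blast
qed

lemma periodic_cube_representative:
  fixes u :: "real^'n \<Rightarrow> 'b"
  assumes "periodic u"
  obtains y where "y \<in> cube" "u y = u x"
proof
  let ?k = "\<chi> i. - real_of_int \<lfloor>x $ i\<rfloor>"
  show "u (x + ?k) = u x" using assms by (rule periodic_shift_lattice) simp
  show "x + ?k \<in> cube"
    unfolding cube_iff by (simp; linarith)
qed

lemma periodic_translate: "periodic u \<Longrightarrow> periodic (\<lambda>x. u (x + a))"
  by (simp add: periodic_def add_ac) (metis add.assoc add.commute)

section \<open>Translation invariance of integrals over a period cell\<close>

lemma integral_split_axis:
  fixes g :: "real^'n \<Rightarrow> 'b::euclidean_space"
  assumes "continuous_on UNIV g" "\<And>j. a $ j \<le> b $ j" "a $ i \<le> c" "c \<le> b $ i"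
  shows "integral (cbox a b) g =
           integral (cbox a (\<chi> j. if j = i then c else b $ j)) g +
           integral (cbox (\<chi> j. if j = i then c else a $ j) b) g"
proof -
  have "g integrable_on cbox a b"
    using assms(1) continuous_on_subset integrable_continuous by blast
  then have "integral (cbox a b) g = integral (cbox a b \<inter> {x. x \<bullet> axis i 1 \<le> c}) g +
      integral (cbox a b \<inter> {x. x \<bullet> axis i 1 \<ge> c}) g"
    by (rule integral_split) (simp add: axis_in_Basis_iff)
  moreover have "cbox a b \<inter> {x. x \<bullet> axis i 1 \<le> c} = cbox a (\<chi> j. if j = i then c else b $ j)"
    using assms(4) by (auto simp: mem_box_cart inner_axis split: if_splits) (metis order.trans)+
  moreover have "cbox a b \<inter> {x. x \<bullet> axis i 1 \<ge> c} = cbox (\<chi> j. if j = i then c else a $ j) b"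
    using assms(3) by (auto simp: mem_box_cart inner_axis split: if_splits) (metis order.trans)+
  ultimately show ?thesis by simp
qed

lemma integral_cbox_shift:
  fixes g :: "'a::euclidean_space \<Rightarrow> 'b::euclidean_space"
  shows "integral (cbox a b) (\<lambda>x. g (x + c)) = integral (cbox (a + c) (b + c)) g"
  using integral_shift_cbox_plus[of a b g c] by (simp add: o_def add.commute)

text \<open>The box from 0 to \<open>One + axis i s\<close> is cut in coordinate i once at height s
  and once at height 1. The two slabs that are left over differ by a translation by one period, so
  the two remaining unit cubes carry the same integral.\<close>

lemma integral_periodic_shift_axis:
  fixes g :: "real^'n \<Rightarrow> 'b::euclidean_space"
  assumes g: "continuous_on UNIV g" "periodic g" and s: "0 \<le> s" "s \<le> 1"
  shows "integral cube (\<lambda>x. g (x + axis i s)) = integral cube g"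
proof -
  let ?b = "\<lambda>r. \<chi> j. if j = i then r else (1::real)"
  let ?b' = "One + axis i s"
  have "integral (cbox 0 ?b') g = integral (cbox 0 (?b s)) g + integral (cbox (axis i s) ?b') g"
  proof -
    have "(\<chi> j. if j = i then s else ?b' $ j) = ?b s"
      and "(\<chi> j. if j = i then s else (0 :: real^'n) $ j) = axis i s"
      by (simp_all add: vec_eq_iff axis_def)
    moreover have "\<And>j. (0 :: real^'n) $ j \<le> ?b' $ j" "s \<le> ?b' $ i"
      using s by (simp_all add: axis_def)
    ultimately show ?thesis
      using integral_split_axis[OF g(1), of 0 ?b' i s] s by simp
  qed
  moreover have "integral (cbox 0 ?b') g = integral cube g + integral (cbox (axis i 1) ?b') g"
  proof -
    have "(\<chi> j. if j = i then 1 else ?b' $ j) = One"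
      and "(\<chi> j. if j = i then 1 else (0 :: real^'n) $ j) = axis i 1"
      by (simp_all add: vec_eq_iff axis_def)
    moreover have "\<And>j. (0 :: real^'n) $ j \<le> ?b' $ j" "1 \<le> ?b' $ i"
      using s by (simp_all add: axis_def)
    ultimately show ?thesis
      using integral_split_axis[OF g(1), of 0 ?b' i 1] by simp
  qed
  moreover have "integral (cbox (axis i 1) ?b') g = integral (cbox 0 (?b s)) g"
  proof -
    have "?b' = ?b s + axis i 1" by (simp add: vec_eq_iff axis_def)
    then have "integral (cbox (axis i 1) ?b') g = integral (cbox 0 (?b s)) (\<lambda>x. g (x + axis i 1))"
      by (simp add: integral_cbox_shift)
    then show ?thesis using g(2) by (simp add: periodic_def)
  qed
  ultimately have "integral (cbox (axis i s) ?b') g = integral cube g" by simp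
  then show ?thesis by (simp add: integral_cbox_shift)
qed

lemma continuous_on_translate:
  "continuous_on UNIV g \<Longrightarrow> continuous_on UNIV (\<lambda>x. g (x + a :: 'a::real_normed_vector))"
  by (rule continuous_on_compose2[of UNIV g]) (auto intro!: continuous_intros)

lemma integral_periodic_shift:
  fixes g :: "real^'n \<Rightarrow> 'b::euclidean_space"
  assumes "continuous_on UNIV g" "periodic g"
  shows "integral cube (\<lambda>x. g (x + a)) = integral cube g"
proof -
  \<comment> \<open>The function is quantified inside the induction because the sum case applies the
    hypothesis for \<open>x\<close> to the translate of \<open>g\<close> by
    \<open>y\<close>.\<close>
  have "\<forall>g :: real^'n \<Rightarrow> 'b. continuous_on UNIV g \<longrightarrow> periodic g \<longrightarrow>
          integral cube (\<lambda>x. g (x + a)) = integral cube g"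
  proof (induction a rule: vec_axis_induct)
    case (add x y)
    show ?case
    proof (intro allI impI)
      fix g :: "real^'n \<Rightarrow> 'b" assume g: "continuous_on UNIV g" "periodic g"
      have "integral cube (\<lambda>z. g (z + x + y)) = integral cube (\<lambda>z. g (z + y))"
        using add(1)[rule_format, of "\<lambda>z. g (z + y)"] g
        by (simp add: continuous_on_translate periodic_translate)
      also have "\<dots> = integral cube g" using add(2) g by blast
      finally show "integral cube (\<lambda>z. g (z + (x + y))) = integral cube g" by (simp add: add.assoc)
    qed
  next
    case (axis i)
    show ?case
    proof (intro allI impI)
      fix g :: "real^'n \<Rightarrow> 'b" assume g: "continuous_on UNIV g" "periodic g"
      have "x + axis i (a $ i) = x + axis i (frac (a $ i)) + axis i (of_int \<lfloor>a $ i\<rfloor>)" for x :: "real^'n"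
        by (simp add: vec_eq_iff axis_def frac_def)
      then have "g (x + axis i (a $ i)) = g (x + axis i (frac (a $ i)))" for x
        using periodic_shift_int[OF g(2)] by metis
      then show "integral cube (\<lambda>x. g (x + axis i (a $ i))) = integral cube g"
        using integral_periodic_shift_axis[OF g, of "frac (a $ i)" i]
        by (simp add: frac_ge_0 frac_lt_1 less_imp_le)
    qed
  qed
  then show ?thesis using assms by blast
qed

subsection \<open>Continuously differentiable functions on the torus\<close>

text \<open>The derivative is an explicit argument, so that the closure rules below compute
  derivatives along with regularity. Values in an arbitrary normed space cover densities and vector
  fields alike. Continuity is asked only in each fixed direction, which is easy to check and, in
  finite dimension, no weaker than continuity in operator norm.\<close>

definition C1_torus :: "(real^'n \<Rightarrow> 'b::real_normed_vector) \<Rightarrow> (real^'n \<Rightarrow> real^'n \<Rightarrow> 'b) \<Rightarrow> bool" where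
  "C1_torus u u' \<longleftrightarrow> periodic u \<and> (\<forall>x. (u has_derivative u' x) (at x)) \<and>
     (\<forall>v. continuous_on UNIV (\<lambda>x. u' x v))"

lemma C1_torus_periodic: "C1_torus u u' \<Longrightarrow> periodic u"
  and C1_torus_has_derivative: "C1_torus u u' \<Longrightarrow> (u has_derivative u' x) (at x)"
  and C1_torus_deriv_continuous: "C1_torus u u' \<Longrightarrow> continuous_on UNIV (\<lambda>x. u' x v)"
  by (simp_all add: C1_torus_def)

lemma C1_torus_continuous: "C1_torus u u' \<Longrightarrow> continuous_on S u"
  by (meson C1_torus_has_derivative has_derivative_continuous continuous_at_imp_continuous_on)

lemma C1_torus_bounded_linear: "C1_torus u u' \<Longrightarrow> bounded_linear (u' x)"
  using C1_torus_has_derivative has_derivative_bounded_linear by blast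

lemma has_derivative_shift:
  assumes "(u has_derivative D) (at (x + a))"
  shows "((\<lambda>y. u (y + a)) has_derivative D) (at x)"
proof -
  have "((\<lambda>y. y + a) has_derivative (\<lambda>h. h)) (at x)"
    by (auto intro!: derivative_eq_intros)
  from has_derivative_compose[OF this assms] show ?thesis .
qed

lemma C1_torus_deriv_periodic:
  assumes "C1_torus u u'"
  shows "periodic (\<lambda>x. u' x v)"
proof -
  have "u' (x + axis i 1) = u' x" for x i
  proof -
    have "((\<lambda>y. u (y + axis i 1)) has_derivative u' (x + axis i 1)) (at x)"
      by (rule has_derivative_shift[OF C1_torus_has_derivative[OF assms]])
    then have "(u has_derivative u' (x + axis i 1)) (at x)"
      using C1_torus_periodic[OF assms] by (simp add: periodic_def)
    then show ?thesis
      using has_derivative_unique C1_torus_has_derivative[OF assms] by blast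
  qed
  then show ?thesis by (simp add: periodic_def)
qed

text \<open>A linear map on a finite-dimensional space is controlled by its values on a basis, so
  directionwise continuity upgrades to operator norm. This is what lets the direction vary together
  with the point, and what differentiation under the integral of a convolution requires.\<close>

lemma C1_torus_deriv_blinfun:
  fixes u :: "real^'n \<Rightarrow> 'b::euclidean_space"
  assumes "C1_torus u u'"
  obtains D :: "real^'n \<Rightarrow> ((real^'n) \<Rightarrow>\<^sub>L 'b)" where "\<And>x. blinfun_apply (D x) = u' x" "continuous_on UNIV D"
proof
  show "\<And>x. blinfun_apply (Blinfun (u' x)) = u' x"
    by (simp add: C1_torus_bounded_linear[OF assms] bounded_linear_Blinfun_apply)
  then show "continuous_on UNIV (\<lambda>x. Blinfun (u' x))"
    using C1_torus_deriv_continuous[OF assms] by (intro continuous_on_blinfun_componentwise) simp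
qed

lemma C1_torus_deriv_continuous_Pair:
  fixes u :: "real^'n \<Rightarrow> 'b::euclidean_space"
  assumes "C1_torus u u'" "continuous_on S f" "continuous_on S g"
  shows "continuous_on S (\<lambda>p. u' (f p) (g p))"
proof -
  obtain D where D: "\<And>x. blinfun_apply (D x) = u' x" "continuous_on UNIV D"
    using C1_torus_deriv_blinfun[OF assms(1)] by blast
  have "continuous_on S (\<lambda>p. blinfun_apply (D (f p)) (g p))"
    by (intro continuous_intros assms continuous_on_compose2[OF D(2)]) auto
  then show ?thesis by (simp add: D)
qed

lemma C1_torus_compose_continuous:
  assumes "C1_torus u u'" "continuous_on S f"
  shows "continuous_on S (\<lambda>p. u (f p))"
  by (rule continuous_on_compose2[OF C1_torus_continuous[OF assms(1), of UNIV] assms(2)]) auto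

lemma C1_torus_bilinear:
  assumes "bounded_bilinear pr" "C1_torus u u'" "C1_torus w w'"
  shows "C1_torus (\<lambda>x. pr (u x) (w x)) (\<lambda>x v. pr (u x) (w' x v) + pr (u' x v) (w x))"
  unfolding C1_torus_def
proof (intro conjI allI)
  show "periodic (\<lambda>x. pr (u x) (w x))"
    using assms by (simp add: periodic_def C1_torus_def)
  show "((\<lambda>x. pr (u x) (w x)) has_derivative (\<lambda>v. pr (u x) (w' x v) + pr (u' x v) (w x))) (at x)" for x
    using assms by (intro bounded_bilinear.FDERIV[OF assms(1)]) (auto simp: C1_torus_def)
  show "continuous_on UNIV (\<lambda>x. pr (u x) (w' x v) + pr (u' x v) (w x))" for v
    by (intro continuous_on_add bounded_bilinear.continuous_on[OF assms(1)]
          C1_torus_continuous[OF assms(2)] C1_torus_continuous[OF assms(3)]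
          C1_torus_deriv_continuous[OF assms(2)] C1_torus_deriv_continuous[OF assms(3)])
qed

lemmas C1_torus_mult = C1_torus_bilinear[OF bounded_bilinear_mult]
lemmas C1_torus_scaleR = C1_torus_bilinear[OF bounded_bilinear_scaleR]

lemma C1_torus_linear:
  assumes "bounded_linear L" "C1_torus u u'"
  shows "C1_torus (\<lambda>x. L (u x)) (\<lambda>x v. L (u' x v))"
  unfolding C1_torus_def
proof (intro conjI allI)
  show "periodic (\<lambda>x. L (u x))"
    using C1_torus_periodic[OF assms(2)] by (simp add: periodic_def)
  show "((\<lambda>x. L (u x)) has_derivative (\<lambda>v. L (u' x v))) (at x)" for x
    by (rule bounded_linear.has_derivative[OF assms(1) C1_torus_has_derivative[OF assms(2)]])
  show "continuous_on UNIV (\<lambda>x. L (u' x v))" for v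
    by (rule bounded_linear.continuous_on[OF assms(1) C1_torus_deriv_continuous[OF assms(2)]])
qed

lemma C1_torus_add:
  assumes "C1_torus u u'" "C1_torus w w'"
  shows "C1_torus (\<lambda>x. u x + w x) (\<lambda>x v. u' x v + w' x v)"
  using assms by (simp add: C1_torus_def periodic_def has_derivative_add continuous_on_add)

lemma C1_torus_diff:
  assumes "C1_torus u u'" "C1_torus w w'"
  shows "C1_torus (\<lambda>x. u x - w x) (\<lambda>x v. u' x v - w' x v)"
  using assms by (simp add: C1_torus_def periodic_def has_derivative_diff continuous_on_diff)

lemma C1_torus_exp:
  assumes "C1_torus u u'"
  shows "C1_torus (\<lambda>x. exp (u x) :: real) (\<lambda>x v. exp (u x) * u' x v)"
  unfolding C1_torus_def
proof (intro conjI allI)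
  show "periodic (\<lambda>x. exp (u x))"
    using C1_torus_periodic[OF assms] by (simp add: periodic_def)
  show "((\<lambda>x. exp (u x)) has_derivative (\<lambda>v. exp (u x) * u' x v)) (at x)" for x
    using has_derivative_exp[OF C1_torus_has_derivative[OF assms]] by (simp add: mult.commute)
  show "continuous_on UNIV (\<lambda>x. exp (u x) * u' x v)" for v
    by (intro continuous_on_mult continuous_on_exp C1_torus_continuous[OF assms]
          C1_torus_deriv_continuous[OF assms])
qed

text \<open>By translation invariance the integral of u(x + s v) over x is constant in s.
  Differentiating under the integral at s = 0 gives the claim without any boundary terms.\<close>

lemma integral_deriv_eq_0:
  fixes u :: "real^'n \<Rightarrow> 'b::euclidean_space"
  assumes u: "C1_torus u u'"
  shows "integral cube (\<lambda>x. u' x v) = 0"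
proof -
  have "((\<lambda>s. integral cube (\<lambda>x. u (x + s *\<^sub>R v))) has_vector_derivative
          integral cube (\<lambda>x. u' (x + 0 *\<^sub>R v) v)) (at 0 within UNIV)"
  proof (rule leibniz_rule_vector_derivative)
    show "((\<lambda>s. u (x + s *\<^sub>R v)) has_vector_derivative u' (x + s *\<^sub>R v) v) (at s within UNIV)" for s x
    proof -
      have "((\<lambda>s. x + s *\<^sub>R v) has_derivative (\<lambda>h. h *\<^sub>R v)) (at s)"
        by (auto intro!: derivative_eq_intros)
      from has_derivative_compose[OF this C1_torus_has_derivative[OF u]]
      show ?thesis
        unfolding has_vector_derivative_def
        by (simp add: linear_cmul[OF bounded_linear.linear[OF C1_torus_bounded_linear[OF u]]])
    qed
    show "(\<lambda>x. u (x + s *\<^sub>R v)) integrable_on cube" for s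
      by (intro integrable_continuous C1_torus_compose_continuous[OF u] continuous_intros)
    show "continuous_on (UNIV \<times> cube) (\<lambda>(s, x). u' (x + s *\<^sub>R v) v)"
      unfolding case_prod_unfold
      by (intro C1_torus_deriv_continuous_Pair[OF u] continuous_intros)
  qed auto
  moreover have "integral cube (\<lambda>x. u (x + s *\<^sub>R v)) = integral cube u" for s
    using integral_periodic_shift C1_torus_continuous[OF u] C1_torus_periodic[OF u] by blast
  ultimately have "((\<lambda>s. integral cube u) has_vector_derivative integral cube (\<lambda>x. u' x v)) (at (0::real))"
    by simp
  then show ?thesis
    using has_vector_derivative_const vector_derivative_unique_at by blast
qed

section \<open>Gradient, divergence and integration by parts\<close>

lemma grad_eqI:
  assumes "(u has_derivative D) (at x)"
  shows "grad u x = (\<chi> i. D (axis i 1))"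
  using frechet_derivative_at[OF assms] by (simp add: grad_def)

lemma derivative_eq_grad:
  fixes u :: "real^'n \<Rightarrow> real"
  assumes "(u has_derivative D) (at x)"
  shows "D v = grad u x \<bullet> v"
proof -
  have lin: "linear D" using assms has_derivative_linear by blast
  have "D v = D (\<Sum>i\<in>UNIV. v $ i *\<^sub>R axis i 1)"
    by (simp add: scaleR_axis vec_sum_axis)
  also have "\<dots> = grad u x \<bullet> v"
    by (simp add: linear_sum[OF lin] linear_cmul[OF lin] grad_eqI[OF assms] inner_vec_def mult.commute)
  finally show ?thesis .
qed

lemma divergence_eqI:
  assumes "(F has_derivative D) (at x)"
  shows "divergence F x = (\<Sum>i\<in>UNIV. D (axis i 1) $ i)"
  using frechet_derivative_at[OF assms] by (simp add: divergence_def trace_def matrix_def)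

lemma C1_torus_grad_continuous:
  fixes u :: "real^'n \<Rightarrow> real"
  assumes "C1_torus u u'"
  shows "continuous_on S (grad u)"
proof -
  have "grad u = (\<lambda>x. \<chi> i. u' x (axis i 1))"
    using grad_eqI C1_torus_has_derivative[OF assms] by blast
  moreover have "continuous_on UNIV (\<lambda>x. \<chi> i. u' x (axis i 1))"
    using C1_torus_deriv_continuous[OF assms] by (intro continuous_intros)
  ultimately show ?thesis using continuous_on_subset by fastforce
qed

lemma C1_torus_divergence_continuous:
  assumes "C1_torus F F'"
  shows "continuous_on S (divergence F)"
proof -
  have "divergence F = (\<lambda>x. \<Sum>i\<in>UNIV. F' x (axis i 1) $ i)"
    using divergence_eqI C1_torus_has_derivative[OF assms] by blast
  moreover have "continuous_on UNIV (\<lambda>x. \<Sum>i\<in>UNIV. F' x (axis i 1) $ i)"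
    using C1_torus_deriv_continuous[OF assms] by (intro continuous_intros)
  ultimately show ?thesis using continuous_on_subset by fastforce
qed

text \<open>The two integrands add up to the divergence of g F. Its i-th summand \<open>?P i\<close>
  is a partial derivative of the periodic function g F_i and integrates to zero.\<close>

lemma integral_divergence_by_parts:
  fixes g :: "real^'n \<Rightarrow> real"
  assumes g: "C1_torus g g'" and F: "C1_torus F F'"
  shows "integral cube (\<lambda>x. g x * divergence F x) = - integral cube (\<lambda>x. grad g x \<bullet> F x)"
proof -
  let ?P = "\<lambda>i x. g x * F' x (axis i 1) $ i + g' x (axis i 1) * F x $ i"
  have comp: "C1_torus (\<lambda>x. g x * F x $ i) (\<lambda>x v. g x * F' x v $ i + g' x v * F x $ i)" for i
    by (intro C1_torus_mult g C1_torus_linear[OF bounded_linear_vec_nth F])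
  have "g x * divergence F x + grad g x \<bullet> F x = (\<Sum>i\<in>UNIV. ?P i x)" for x
    by (simp add: divergence_eqI[OF C1_torus_has_derivative[OF F]] sum.distrib sum_distrib_left
          grad_eqI[OF C1_torus_has_derivative[OF g]] inner_vec_def)
  then have "integral cube (\<lambda>x. g x * divergence F x + grad g x \<bullet> F x) = integral cube (\<lambda>x. \<Sum>i\<in>UNIV. ?P i x)"
    by simp
  also have "\<dots> = (\<Sum>i\<in>UNIV. integral cube (?P i))"
    by (intro integral_sum integrable_continuous continuous_on_subset[OF C1_torus_deriv_continuous[OF comp]]) auto
  also have "\<dots> = 0"
    using integral_deriv_eq_0[OF comp] by simp
  finally show ?thesis
    by (subst (asm) integral_add)
      (auto intro!: integrable_continuous continuous_intros C1_torus_continuous[OF g] C1_torus_continuous[OF F]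
        C1_torus_grad_continuous[OF g] C1_torus_divergence_continuous[OF F])
qed

subsection \<open>A dimension-free Poincare inequality\<close>

lemma integrable_cbox_continuous_UNIV:
  fixes g :: "'a::euclidean_space \<Rightarrow> 'b::banach"
  shows "continuous_on UNIV g \<Longrightarrow> g integrable_on cbox a b"
  using continuous_on_subset integrable_continuous by blast

text \<open>Nonnegativity of the variance on a box of measure 1. It serves both on the unit
  interval, along segments, and on the cube, to compare the L^1 and L^2 norms.\<close>

lemma integral_square_le:
  fixes f :: "'a::euclidean_space \<Rightarrow> real"
  assumes f: "continuous_on (cbox a b) f" and "measure lborel (cbox a b) = 1"
  shows "(integral (cbox a b) f)\<^sup>2 \<le> integral (cbox a b) (\<lambda>x. (f x)\<^sup>2)"
proof -
  define m where "m = integral (cbox a b) f"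
  have int: "f integrable_on cbox a b" "(\<lambda>x. (f x)\<^sup>2) integrable_on cbox a b"
    by (intro integrable_continuous continuous_intros f)+
  have "((\<lambda>x. (f x)\<^sup>2 - 2 * m * f x + m\<^sup>2) has_integral
      (integral (cbox a b) (\<lambda>x. (f x)\<^sup>2) - 2 * m * m + measure lborel (cbox a b) *\<^sub>R m\<^sup>2)) (cbox a b)"
    using int unfolding m_def
    by (intro has_integral_add has_integral_diff has_integral_mult_right has_integral_const
          integrable_integral)
  moreover have "0 \<le> (f x)\<^sup>2 - 2 * m * f x + m\<^sup>2" for x
    using zero_le_power2[of "f x - m"] by (simp add: power2_diff mult_ac)
  ultimately have "0 \<le> integral (cbox a b) (\<lambda>x. (f x)\<^sup>2) - 2 * m * m + measure lborel (cbox a b) *\<^sub>R m\<^sup>2"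
    using has_integral_nonneg by blast
  then show ?thesis using assms(2) by (simp add: m_def power2_eq_square)
qed

section \<open>Second moments of the centered cube\<close>

abbreviation centered_cube :: "(real^'n) set" where
  "centered_cube \<equiv> cbox (- ((1/2) *\<^sub>R One)) ((1/2) *\<^sub>R One)"

lemma centered_cube_iff: "x \<in> centered_cube \<longleftrightarrow> (\<forall>i. \<bar>x $ i\<bar> \<le> 1/2)"
  unfolding mem_box_cart by (intro iff_allI) (simp; linarith)

lemma content_centered_cube: "measure lborel (centered_cube :: (real^'n) set) = 1"
  by (subst content_cbox) (simp_all add: inner_sum_left inner_Basis)

text \<open>Reflecting the i-th coordinate preserves the centered cube and changes the sign of the
  integrand.\<close>

lemma integral_centered_cube_mixed:
  assumes "i \<noteq> j"
  shows "integral centered_cube (\<lambda>z :: real^'n. z $ i * z $ j) = 0"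
proof -
  let ?q = "\<lambda>z :: real^'n. z $ i * z $ j"
  \<comment> \<open>The reflection as a family of stretch factors, in the form used by
    \<open>has_integral_stretch\<close>; \<open>R\<close> is the resulting map.\<close>
  define m :: "real^'n \<Rightarrow> real" where "m k = (if k = axis i 1 then -1 else 1)" for k
  define R :: "real^'n \<Rightarrow> real^'n" where "R x = (\<chi> l. if l = i then - (x $ l) else x $ l)" for x
  have m: "m k \<noteq> 0" "1 / m k = m k" "\<bar>m k\<bar> = 1" for k
    by (simp_all add: m_def)
  have R: "(\<Sum>k\<in>Basis. (m k * (x \<bullet> k)) *\<^sub>R k) = R x" for x
  proof (rule euclidean_eqI)
    fix b :: "real^'n" assume "b \<in> Basis"
    moreover from this obtain l where "b = axis l 1" by (auto simp: Basis_vec_def)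
    ultimately show "(\<Sum>k\<in>Basis. (m k * (x \<bullet> k)) *\<^sub>R k) \<bullet> b = R x \<bullet> b"
      by (subst inner_sum_left_Basis) (auto simp: m_def R_def inner_axis axis_eq_axis)
  qed
  have "?q integrable_on centered_cube"
    by (intro integrable_cbox_continuous_UNIV continuous_intros)
  then have "(?q has_integral integral centered_cube ?q) centered_cube"
    by (rule integrable_integral)
  from has_integral_stretch[OF this, of m]
  have "((\<lambda>x. ?q (R x)) has_integral integral centered_cube ?q) (R ` centered_cube)"
    by (simp add: m R abs_prod)
  moreover have "R ` centered_cube = centered_cube"
  proof -
    have mem: "R x \<in> centered_cube" if "x \<in> centered_cube" for x
      using that by (simp add: centered_cube_iff R_def)
    have "R (R x) = x" for x by (simp add: R_def vec_eq_iff)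
    then have "x \<in> R ` centered_cube" if "x \<in> centered_cube" for x
      using image_eqI[of x R "R x"] mem[OF that] by simp
    then show ?thesis using mem by blast
  qed
  moreover have "?q (R x) = - ?q x" for x using assms by (simp add: R_def)
  ultimately have "((\<lambda>x. - ?q x) has_integral integral centered_cube ?q) centered_cube" by simp
  then have "integral centered_cube (\<lambda>x. - ?q x) = integral centered_cube ?q"
    by (rule integral_unique)
  then show ?thesis by simp
qed

text \<open>Only the diagonal moments survive when the square is expanded. Each is bounded crudely
  by the maximum 1/4 of its integrand instead of its exact value 1/12. This is the origin of the
  Poincare constant 8: twice the integral of u^2 is at most a quarter of the integral of the squared
  gradient.\<close>

lemma integral_centered_cube_inner:
  "integral centered_cube (\<lambda>z. (a \<bullet> z)\<^sup>2) \<le> (norm a)\<^sup>2 / 4" for a :: "real^'n"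
proof -
  have int: "(\<lambda>z :: real^'n. z $ i * z $ j) integrable_on centered_cube" for i j
    by (intro integrable_cbox_continuous_UNIV continuous_intros)
  have diag: "integral centered_cube (\<lambda>z :: real^'n. z $ i * z $ i) \<le> 1/4" for i
  proof -
    have "integral centered_cube (\<lambda>z :: real^'n. z $ i * z $ i) \<le>
        integral (centered_cube :: (real^'n) set) (\<lambda>z. 1/4)"
    proof (intro integral_le int)
      fix z :: "real^'n" assume "z \<in> centered_cube"
      then have "\<bar>z $ i\<bar> \<le> 1/2" by (simp add: centered_cube_iff)
      then have "\<bar>z $ i\<bar> * \<bar>z $ i\<bar> \<le> 1/2 * (1/2)" by (intro mult_mono) auto
      then show "z $ i * z $ i \<le> 1/4" by (simp add: abs_mult[symmetric])
    qed (simp add: integrable_const)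
    then show ?thesis using content_centered_cube[where ?'n = 'n] by simp
  qed
  have "integral centered_cube (\<lambda>z. (a \<bullet> z)\<^sup>2) =
      integral centered_cube (\<lambda>z :: real^'n. \<Sum>i\<in>UNIV. \<Sum>j\<in>UNIV. (a $ i * a $ j) * (z $ i * z $ j))"
    by (simp add: inner_vec_def power2_eq_square sum_product mult_ac)
  also have "\<dots> = (\<Sum>i\<in>UNIV. \<Sum>j\<in>UNIV. (a $ i * a $ j) * integral centered_cube (\<lambda>z :: real^'n. z $ i * z $ j))"
    by (simp add: integral_sum integrable_sum integrable_on_mult_right int)
  also have "\<dots> = (\<Sum>i\<in>UNIV. \<Sum>j\<in>UNIV. if j = i then
      (a $ i * a $ i) * integral centered_cube (\<lambda>z :: real^'n. z $ i * z $ i) else 0)"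
    by (intro sum.cong refl) (simp add: integral_centered_cube_mixed)
  also have "\<dots> = (\<Sum>i\<in>UNIV. (a $ i * a $ i) * integral centered_cube (\<lambda>z :: real^'n. z $ i * z $ i))"
    by simp
  also have "\<dots> \<le> (\<Sum>i\<in>UNIV. (a $ i * a $ i) * (1/4))"
    by (intro sum_mono mult_left_mono diag) auto
  also have "\<dots> = (norm a)\<^sup>2 / 4"
    by (simp add: power2_norm_eq_inner inner_vec_def sum_divide_distrib)
  finally show ?thesis .
qed

text \<open>The increment is the integral of the directional derivative along the segment from x to
  x + z, so its square is at most the integral of the squared derivative. After swapping the
  integrals, translation invariance removes the dependence on the position along the
  segment.\<close>

lemma integral_increment_square_le:
  fixes u :: "real^'n \<Rightarrow> real"
  assumes u: "C1_torus u u'"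
  shows "integral cube (\<lambda>x. (u (x + z) - u x)\<^sup>2) \<le> integral cube (\<lambda>x. (u' x z)\<^sup>2)"
proof -
  note u_cont = C1_torus_compose_continuous[OF u] and u'_cont = C1_torus_deriv_continuous_Pair[OF u]
  have pt: "(u (x + z) - u x)\<^sup>2 \<le> integral (cbox 0 1) (\<lambda>s. (u' (x + s *\<^sub>R z) z)\<^sup>2)" for x
  proof -
    have vd: "((\<lambda>s. u (x + s *\<^sub>R z)) has_vector_derivative u' (x + s *\<^sub>R z) z) (at s within {0..1})" for s
    proof -
      have "((\<lambda>s. x + s *\<^sub>R z) has_derivative (\<lambda>h. h *\<^sub>R z)) (at s within {0..1})"
        by (auto intro!: derivative_eq_intros)
      from has_derivative_compose[OF this C1_torus_has_derivative[OF u]]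
      show ?thesis
        unfolding has_vector_derivative_def
        by (simp add: linear_cmul[OF bounded_linear.linear[OF C1_torus_bounded_linear[OF u]]])
    qed
    have "((\<lambda>s. u' (x + s *\<^sub>R z) z) has_integral (u (x + 1 *\<^sub>R z) - u (x + 0 *\<^sub>R z))) {0..1}"
      by (rule fundamental_theorem_of_calculus) (use vd in auto)
    then have "integral (cbox 0 1) (\<lambda>s. u' (x + s *\<^sub>R z) z) = u (x + z) - u x"
      by (simp add: integral_unique)
    moreover have "continuous_on (cbox 0 1) (\<lambda>s. u' (x + s *\<^sub>R z) z)"
      by (intro u'_cont continuous_intros)
    ultimately show ?thesis
      using integral_square_le[of 0 "1::real" "\<lambda>s. u' (x + s *\<^sub>R z) z"] by simp
  qed
  have "integral cube (\<lambda>x. (u (x + z) - u x)\<^sup>2) \<le>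
      integral cube (\<lambda>x. integral (cbox 0 1) (\<lambda>s. (u' (x + s *\<^sub>R z) z)\<^sup>2))"
  proof (rule integral_le[OF _ _ pt])
    show "(\<lambda>x. (u (x + z) - u x)\<^sup>2) integrable_on cube"
      by (intro integrable_continuous continuous_intros u_cont)
    show "(\<lambda>x. integral (cbox 0 1) (\<lambda>s. (u' (x + s *\<^sub>R z) z)\<^sup>2)) integrable_on cube"
      by (intro integrable_continuous integral_continuous_on_param, unfold case_prod_unfold)
        (intro continuous_intros u'_cont)
  qed
  also have "\<dots> = integral (cbox 0 1) (\<lambda>s. integral cube (\<lambda>x. (u' (x + s *\<^sub>R z) z)\<^sup>2))"
    by (intro integral_swap_continuous, unfold case_prod_unfold) (intro continuous_intros u'_cont)
  also have "\<dots> = integral (cbox 0 (1::real)) (\<lambda>s. integral cube (\<lambda>x. (u' x z)\<^sup>2))"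
  proof -
    have "integral cube (\<lambda>x. (u' (x + s *\<^sub>R z) z)\<^sup>2) = integral cube (\<lambda>x. (u' x z)\<^sup>2)" for s
      using C1_torus_deriv_periodic[OF u, of z]
      by (intro integral_periodic_shift[of "\<lambda>x. (u' x z)\<^sup>2"] continuous_intros u'_cont)
        (simp add: periodic_def)
    then show ?thesis by simp
  qed
  also have "\<dots> = integral cube (\<lambda>x. (u' x z)\<^sup>2)" by simp
  finally show ?thesis .
qed

text \<open>
  Averaging \<open>\<integral> (u (x + z) - u x)^2 dx\<close> over \<open>z\<close> in the centered cube gives \<open>2 \<integral> u^2\<close>, since the
  cross term vanishes. Each of these integrals is at most \<open>\<integral> (grad u \<bullet> z)^2\<close>, and the
  mixed moments of the centered cube vanish, so no factor of the dimension appears.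
\<close>

lemma poincare_torus:
  fixes u :: "real^'n \<Rightarrow> real"
  assumes u: "C1_torus u u'" and mean: "integral cube u = 0"
  shows "8 * integral cube (\<lambda>x. (u x)\<^sup>2) \<le> integral cube (\<lambda>x. (norm (grad u x))\<^sup>2)"
proof -
  note u_cont = C1_torus_compose_continuous[OF u] and u'_cont = C1_torus_deriv_continuous_Pair[OF u]
  let ?I = "integral cube (\<lambda>x. (u x)\<^sup>2)" and ?D = "centered_cube :: (real^'n) set"
  let ?P = "\<lambda>z. integral cube (\<lambda>x. u x * u (x + z))"
  have grad: "u' x v = grad u x \<bullet> v" for x v
    by (rule derivative_eq_grad[OF C1_torus_has_derivative[OF u]])
  have P_cont: "continuous_on ?D ?P"
    by (intro integral_continuous_on_param, unfold case_prod_unfold) (intro continuous_intros u_cont)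
  have expand: "integral cube (\<lambda>x. (u (x + z) - u x)\<^sup>2) = 2 * ?I - 2 * ?P z" for z
  proof -
    have "(\<lambda>x. (u (x + z) - u x)\<^sup>2) = (\<lambda>x. (u (x + z))\<^sup>2 + (u x)\<^sup>2 - 2 * (u x * u (x + z)))"
      by (simp add: power2_diff mult_ac)
    moreover have "((\<lambda>x. (u (x + z))\<^sup>2 + (u x)\<^sup>2 - 2 * (u x * u (x + z))) has_integral
        (integral cube (\<lambda>x. (u (x + z))\<^sup>2) + ?I - 2 * ?P z)) cube"
      by (intro has_integral_add has_integral_diff has_integral_mult_right integrable_integral
          integrable_continuous continuous_intros u_cont)
    moreover have "integral cube (\<lambda>x. (u (x + z))\<^sup>2) = ?I"
      using C1_torus_periodic[OF u]
      by (intro integral_periodic_shift[of "\<lambda>x. (u x)\<^sup>2"] continuous_intros u_cont)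
        (simp add: periodic_def)
    ultimately show ?thesis by (simp add: integral_unique)
  qed
  have "integral ?D ?P = integral cube (\<lambda>x. integral ?D (\<lambda>z. u x * u (x + z)))"
    by (intro integral_swap_continuous, unfold case_prod_unfold) (intro continuous_intros u_cont)
  also have "\<dots> = 0"
  proof -
    \<comment> \<open>The cross term vanishes because, for fixed x, the average over z runs over a
      full period of \<open>u\<close> and so sees only its mean.\<close>
    have "integral ?D (\<lambda>z. u (x + z)) = 0" for x
    proof -
      let ?h = "(1/2) *\<^sub>R One :: real^'n"
      have "0 + - ?h = - ?h" "One + - ?h = ?h"
        by (simp_all add: vec_eq_iff)
      then have "integral ?D (\<lambda>z. u (x + z)) = integral cube (\<lambda>z. u (x + (z + - ?h)))"
        by (simp only: integral_cbox_shift[where g = "\<lambda>z. u (x + z)"])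
      also have "\<dots> = integral cube (\<lambda>z. u (z + (x - ?h)))"
        by (simp add: algebra_simps)
      also have "\<dots> = 0"
        using mean integral_periodic_shift C1_torus_continuous[OF u] C1_torus_periodic[OF u] by metis
      finally show ?thesis .
    qed
    then show ?thesis by simp
  qed
  finally have P0: "integral ?D ?P = 0" .
  have "((\<lambda>z. 2 * ?I - 2 * ?P z) has_integral (measure lborel ?D *\<^sub>R (2 * ?I) - 2 * integral ?D ?P)) ?D"
    by (intro has_integral_diff has_integral_mult_right has_integral_const integrable_integral
        integrable_continuous P_cont)
  then have "2 * ?I = integral ?D (\<lambda>z. 2 * ?I - 2 * ?P z)"
    using P0 by (simp add: content_centered_cube integral_unique)
  also have "\<dots> \<le> integral ?D (\<lambda>z. integral cube (\<lambda>x. (grad u x \<bullet> z)\<^sup>2))"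
  proof (rule integral_le)
    show "(\<lambda>z. 2 * ?I - 2 * ?P z) integrable_on ?D"
      by (intro integrable_continuous continuous_intros P_cont)
    show "(\<lambda>z. integral cube (\<lambda>x. (grad u x \<bullet> z)\<^sup>2)) integrable_on ?D"
      unfolding grad[symmetric]
      by (intro integrable_continuous integral_continuous_on_param, unfold case_prod_unfold)
        (intro continuous_intros u'_cont)
    show "2 * ?I - 2 * ?P z \<le> integral cube (\<lambda>x. (grad u x \<bullet> z)\<^sup>2)" for z
      using integral_increment_square_le[OF u, of z] by (simp add: expand grad)
  qed
  also have "\<dots> = integral cube (\<lambda>x. integral ?D (\<lambda>z. (grad u x \<bullet> z)\<^sup>2))"
    unfolding grad[symmetric]
    by (intro integral_swap_continuous, unfold case_prod_unfold) (intro continuous_intros u'_cont)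
  also have "\<dots> \<le> integral cube (\<lambda>x. (norm (grad u x))\<^sup>2 / 4)"
  proof (intro integral_le integral_centered_cube_inner)
    show "(\<lambda>x. integral ?D (\<lambda>z. (grad u x \<bullet> z)\<^sup>2)) integrable_on cube"
      unfolding grad[symmetric]
      by (intro integrable_continuous integral_continuous_on_param, unfold case_prod_unfold)
        (intro continuous_intros u'_cont)
    show "(\<lambda>x. (norm (grad u x))\<^sup>2 / 4) integrable_on cube"
      by (intro integrable_continuous continuous_intros C1_torus_grad_continuous[OF u]) auto
  qed
  also have "\<dots> = integral cube (\<lambda>x. (norm (grad u x))\<^sup>2) / 4" by simp
  finally show ?thesis by simp
qed

subsection \<open>Torus integrals, convolutions and sup norms\<close>

lemma integrable_torus_continuous:
  fixes g :: "real^'n \<Rightarrow> 'b::euclidean_space"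
  assumes "continuous_on cube g"
  shows "integrable torus g"
  unfolding torus_def using borel_integrable_compact[OF compact_cbox assms]
  by (subst integrable_restrict_space) auto

lemma LINT_torus_continuous:
  fixes g :: "real^'n \<Rightarrow> 'b::euclidean_space"
  assumes "continuous_on cube g"
  shows "(LINT x|torus. g x) = integral cube g"
proof -
  have "set_integrable lborel cube g"
    unfolding set_integrable_def by (rule borel_integrable_compact[OF compact_cbox assms])
  from set_borel_integral_eq_integral(2)[OF this] show ?thesis
    unfolding torus_def set_lebesgue_integral_def by (subst integral_restrict_space) auto
qed

lemma nn_integral_torus_continuous:
  fixes g :: "real^'n \<Rightarrow> real"
  assumes "continuous_on cube g" "\<And>x. 0 \<le> g x"
  shows "(\<integral>\<^sup>+ x. ennreal (g x) \<partial>torus) = ennreal (integral cube g)"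
  using nn_integral_eq_integral[OF integrable_torus_continuous[OF assms(1)]] assms(2)
  by (simp add: LINT_torus_continuous[OF assms(1)])

lemma borel_measurable_torus: "g \<in> borel_measurable borel \<Longrightarrow> g \<in> borel_measurable torus"
  by (simp add: torus_def measurable_restrict_space1)

section \<open>Convolution with a regular kernel\<close>

lemma conv_continuous:
  fixes K :: "real^'n \<Rightarrow> 'b::euclidean_space"
  assumes "continuous_on UNIV K" "continuous_on UNIV p"
  shows "conv K p x = integral cube (\<lambda>y. p y *\<^sub>R K (x - y))"
  unfolding conv_def
  by (intro LINT_torus_continuous continuous_intros continuous_on_subset[OF assms(2)]
      continuous_on_compose2[OF assms(1)]) auto

text \<open>All derivatives fall on the kernel, so continuity of the density suffices. The
  derivative is first integrated as a bounded linear map \<open>D\<close>; evaluation at a direction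
  then commutes with the integral.\<close>

lemma C1_torus_conv:
  fixes K :: "real^'n \<Rightarrow> 'b::euclidean_space"
  assumes K: "C1_torus K K'" and p: "continuous_on UNIV p"
  shows "C1_torus (conv K p) (\<lambda>x v. conv (\<lambda>z. K' z v) p x)"
proof -
  note K_cont = C1_torus_continuous[OF K] and K'_cont = C1_torus_deriv_continuous[OF K]
  have p_snd: "continuous_on S (\<lambda>q. p (snd q))" for S :: "((real^'n) \<times> (real^'n)) set"
    by (rule continuous_on_compose2[OF p]) (auto intro!: continuous_intros)
  have p_cube: "continuous_on S p" for S
    using p continuous_on_subset by blast
  have conv_K: "conv K p = (\<lambda>x. integral cube (\<lambda>y. p y *\<^sub>R K (x - y)))"
    by (rule ext) (rule conv_continuous[OF K_cont p])
  have conv_K': "conv (\<lambda>z. K' z v) p x = integral cube (\<lambda>y. p y *\<^sub>R K' (x - y) v)" for x v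
    by (rule conv_continuous[OF K'_cont p])
  obtain D where D: "\<And>x. blinfun_apply (D x) = K' x" "continuous_on UNIV D"
    using C1_torus_deriv_blinfun[OF K] by blast
  have D_comp: "continuous_on S (\<lambda>q. D (g q))"
    if "continuous_on S g" for S :: "'c::topological_space set" and g
    by (rule continuous_on_compose2[OF D(2) that]) auto
  show ?thesis
    unfolding C1_torus_def
  proof (intro conjI allI)
    have "K (x + axis i 1 - y) = K (x - y)" for x y i
      using C1_torus_periodic[OF K] unfolding periodic_def by (simp add: diff_add_eq[symmetric])
    then show "periodic (conv K p)"
      by (simp add: periodic_def conv_K)
    show "(conv K p has_derivative (\<lambda>v. conv (\<lambda>z. K' z v) p x)) (at x)" for x
    proof -
      have "((\<lambda>x. integral cube (\<lambda>y. p y *\<^sub>R K (x - y))) has_derivative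
          blinfun_apply (integral cube (\<lambda>y. p y *\<^sub>R D (x - y)))) (at x within UNIV)"
      proof (rule leibniz_rule)
        show "((\<lambda>x. p y *\<^sub>R K (x - y)) has_derivative blinfun_apply (p y *\<^sub>R D (x - y))) (at x within UNIV)" for x y
        proof -
          have "(K has_derivative K' (x - y)) (at (x + (- y)))"
            using C1_torus_has_derivative[OF K] by simp
          from has_derivative_scaleR_right[OF has_derivative_shift[OF this], of "p y"]
          have "((\<lambda>x. p y *\<^sub>R K (x - y)) has_derivative (\<lambda>v. p y *\<^sub>R K' (x - y) v)) (at x)"
            by simp
          moreover have "blinfun_apply (p y *\<^sub>R D (x - y)) = (\<lambda>v. p y *\<^sub>R K' (x - y) v)"
            by (simp add: fun_eq_iff scaleR_blinfun.rep_eq D(1))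
          ultimately show ?thesis by simp
        qed
        show "(\<lambda>y. p y *\<^sub>R K (x - y)) integrable_on cube" for x
          by (intro integrable_continuous continuous_on_scaleR p_cube C1_torus_compose_continuous[OF K]
              continuous_on_diff continuous_on_const continuous_on_id)
        show "continuous_on (UNIV \<times> cube) (\<lambda>(x, y). p y *\<^sub>R D (x - y))"
          unfolding case_prod_unfold
          by (intro continuous_on_scaleR p_snd D_comp continuous_on_diff continuous_on_fst
              continuous_on_snd continuous_on_id)
      qed auto
      moreover have "blinfun_apply (integral cube (\<lambda>y. p y *\<^sub>R D (x - y))) = (\<lambda>v. conv (\<lambda>z. K' z v) p x)"
      proof (rule ext)
        fix v
        have "(\<lambda>y. p y *\<^sub>R D (x - y)) integrable_on cube"
          by (intro integrable_continuous continuous_on_scaleR p_cube D_comp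
              continuous_on_diff continuous_on_const continuous_on_id)
        then show "blinfun_apply (integral cube (\<lambda>y. p y *\<^sub>R D (x - y))) v = conv (\<lambda>z. K' z v) p x"
          by (simp add: blinfun_apply_integral conv_K' scaleR_blinfun.rep_eq D(1))
      qed
      ultimately show ?thesis by (simp add: conv_K)
    qed
    show "continuous_on UNIV (\<lambda>x. conv (\<lambda>z. K' z v) p x)" for v
      unfolding conv_K'
      by (intro integral_continuous_on_param, unfold case_prod_unfold)
        (intro continuous_on_scaleR p_snd C1_torus_deriv_continuous_Pair[OF K] continuous_on_diff
          continuous_on_fst continuous_on_snd continuous_on_id continuous_on_const)
  qed
qed

text \<open>Young's convolution inequality for a bounded kernel and an L^1 factor. For a probability
  density the mass factor is 1; for a difference of densities it is bounded by the L^2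
  distance.\<close>

lemma conv_norm_le:
  fixes K :: "real^'n \<Rightarrow> 'b::euclidean_space"
  assumes K: "continuous_on UNIV K" "\<And>z. norm (K z) \<le> B" and p: "continuous_on UNIV p"
  shows "norm (conv K p x) \<le> B * integral cube (\<lambda>y. \<bar>p y\<bar>)"
proof -
  have p_cube: "continuous_on cube p" using p continuous_on_subset by blast
  have "norm (integral cube (\<lambda>y. p y *\<^sub>R K (x - y))) \<le> integral cube (\<lambda>y. B * \<bar>p y\<bar>)"
  proof (rule integral_norm_bound_integral)
    show "(\<lambda>y. p y *\<^sub>R K (x - y)) integrable_on cube"
      by (intro integrable_continuous continuous_intros p_cube continuous_on_compose2[OF K(1)]) auto
    show "(\<lambda>y. B * \<bar>p y\<bar>) integrable_on cube"
      by (intro integrable_continuous continuous_intros p_cube)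
    show "norm (p y *\<^sub>R K (x - y)) \<le> B * \<bar>p y\<bar>" for y
      using mult_right_mono[OF K(2)[of "x - y"], of "\<bar>p y\<bar>"] by (simp add: mult.commute)
  qed
  then show ?thesis by (simp add: conv_continuous[OF K(1) p])
qed

section \<open>From \<open>C2_torus\<close> to \<open>C1_torus\<close>, and pointwise bounds from
  \<open>Linf_norm\<close>\<close>

lemma C2_torus_C1_torus_grad:
  assumes "C2_torus u"
  shows "C1_torus (grad u) (\<lambda>x v. hessian u x *v v)"
  unfolding C1_torus_def
proof (intro conjI allI)
  have per: "u (y + axis i 1) = u y" for y i
    using assms by (simp add: C2_torus_def periodic_def)
  show "periodic (grad u)"
    unfolding periodic_def
  proof (intro allI)
    fix x i
    have "(u has_derivative frechet_derivative u (at (x + axis i 1))) (at (x + axis i 1))"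
      using assms by (simp add: C2_torus_def frechet_derivative_works[symmetric])
    from has_derivative_shift[OF this]
    have "(u has_derivative frechet_derivative u (at (x + axis i 1))) (at x)" by (simp add: per)
    from grad_eqI[OF this] show "grad u (x + axis i 1) = grad u x" by (simp add: grad_def)
  qed
  show "(grad u has_derivative (\<lambda>v. hessian u x *v v)) (at x)" for x
  proof -
    have "(grad u has_derivative frechet_derivative (grad u) (at x)) (at x)"
      using assms by (simp add: C2_torus_def frechet_derivative_works[symmetric])
    moreover from this have "frechet_derivative (grad u) (at x) = (\<lambda>v. hessian u x *v v)"
      by (simp add: fun_eq_iff hessian_def matrix_works has_derivative_linear)
    ultimately show ?thesis by simp
  qed
  show "continuous_on UNIV (\<lambda>x. hessian u x *v v)" for v
  proof -
    have "continuous_on UNIV (hessian u)" using assms by (simp add: C2_torus_def)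
    then show ?thesis
      unfolding matrix_vector_mult_def by (intro continuous_intros)
  qed
qed

lemma C2_torus_C1_torus:
  assumes "C2_torus u"
  shows "C1_torus u (\<lambda>x v. grad u x \<bullet> v)"
  unfolding C1_torus_def
proof (intro conjI allI)
  show "periodic u" using assms by (simp add: C2_torus_def)
  show "(u has_derivative (\<lambda>v. grad u x \<bullet> v)) (at x)" for x
  proof -
    have D: "(u has_derivative frechet_derivative u (at x)) (at x)"
      using assms by (simp add: C2_torus_def frechet_derivative_works[symmetric])
    then have "frechet_derivative u (at x) = (\<lambda>v. grad u x \<bullet> v)"
      using derivative_eq_grad[OF D] by blast
    then show ?thesis using D by simp
  qed
  show "continuous_on UNIV (\<lambda>x. grad u x \<bullet> v)" for v
    by (intro continuous_on_inner continuous_on_const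
        C1_torus_continuous[OF C2_torus_C1_torus_grad[OF assms]])
qed

text \<open>For continuous \<open>u\<close> the set where the essential bound holds is closed.
  Having full measure in the open unit box, it contains the box and then its closure; periodicity
  covers the rest of the space.\<close>

lemma norm_le_Linf_norm:
  fixes u :: "real^'n \<Rightarrow> 'b::real_normed_vector"
  assumes cont: "continuous_on UNIV u" and per: "periodic u"
  shows "norm (u x) \<le> Linf_norm u"
proof -
  let ?f = "\<lambda>x. ereal (norm (u x))"
  have cont': "continuous_on UNIV (\<lambda>x. norm (u x))" by (intro continuous_intros cont)
  have "?f \<in> borel_measurable borel"
    by (intro borel_measurable_ereal borel_measurable_continuous_onI cont')
  then have meas: "?f \<in> borel_measurable torus" by (simp add: torus_def measurable_restrict_space1)
  have torus_AE: "(AE x in torus. P x) \<longleftrightarrow> (AE x in lborel. x \<in> cube \<longrightarrow> P x)" for P :: "real^'n \<Rightarrow> bool"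
    unfolding torus_def by (rule AE_restrict_space_iff) simp
  define E where "E = esssup torus ?f"
  have AE: "AE x in lborel. x \<in> cube \<longrightarrow> ?f x \<le> E"
    using esssup_AE[of ?f torus] by (simp add: torus_AE E_def)
  \<comment> \<open>Both infinite values of \<open>E\<close> must be excluded, since
    \<open>real_of_ereal\<close> sends them to 0. Compactness excludes the positive one; the
    negative one would make the unit cube a null set.\<close>
  have "compact ((\<lambda>x. norm (u x)) ` cube)"
    by (intro compact_continuous_image continuous_on_subset[OF cont'] compact_cbox) auto
  then obtain M where "\<forall>x\<in>cube. norm (u x) \<le> M"
    by (auto dest!: compact_imp_bounded simp: bounded_iff)
  then have "E \<le> ereal M"
    unfolding E_def by (intro esssup_I meas) (simp add: torus_AE)
  moreover have "E \<noteq> -\<infinity>"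
  proof
    assume "E = -\<infinity>"
    then have "AE x in lborel. x \<notin> (cube :: (real^'n) set)" using AE by simp
    then have "emeasure lborel (cube :: (real^'n) set) = 0"
      by (subst (asm) AE_iff_measurable[OF _ refl]) auto
    then show False
      using content_unit[where ?'a = "real^'n"] by (simp add: measure_def)
  qed
  ultimately obtain r where r: "E = ereal r" by (cases E) auto
  then have rL: "Linf_norm u = r" by (simp add: Linf_norm_def E_def)
  define C where "C = {x. norm (u x) \<le> r}"
  have closed: "closed C"
    unfolding C_def by (intro closed_Collect_le cont' continuous_on_const)
  have "AE x in lborel. x \<in> cube \<longrightarrow> norm (u x) \<le> r" using AE by (simp add: r)
  then have "AE x in lebesgue. x \<in> cube \<longrightarrow> norm (u x) \<le> r" by (rule AE_completion)
  then have "AE x\<in>box 0 One in lebesgue. x \<in> C"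
    by eventually_elim (use box_subset_cbox in \<open>auto simp: C_def\<close>)
  then have "box 0 One \<subseteq> C"
    using mem_closed_if_AE_lebesgue_open[OF open_box closed] by blast
  then have "cube \<subseteq> C"
    using closure_minimal[OF _ closed] closure_box[OF box01_nonempty] by blast
  moreover obtain y where "y \<in> cube" "u y = u x"
    using periodic_cube_representative[OF per] by blast
  ultimately show ?thesis by (auto simp: rL C_def) 
qed

subsection \<open>Stationary densities and energy dissipation\<close>

lemma prob_density_integral:
  assumes "prob_density p" "continuous_on UNIV p"
  shows "integral cube p = 1"
proof -
  have nn: "\<And>x. 0 \<le> p x" and "continuous_on cube p"
    using assms continuous_on_subset by (auto simp: prob_density_def)
  then have "ennreal (integral cube p) = 1"
    using nn_integral_torus_continuous[of p] assms(1) by (simp add: prob_density_def)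
  then show ?thesis by simp
qed

lemma conv_diff:
  fixes K :: "real^'n \<Rightarrow> 'b::euclidean_space"
  assumes "continuous_on UNIV K" "continuous_on UNIV p" "continuous_on UNIV q"
  shows "conv K (\<lambda>x. p x - q x) x = conv K p x - conv K q x"
proof -
  have int: "(\<lambda>y. r y *\<^sub>R K (x - y)) integrable_on cube" if "continuous_on UNIV r" for r :: "real^'n \<Rightarrow> real"
    by (intro integrable_continuous continuous_intros continuous_on_subset[OF that]
        continuous_on_compose2[OF assms(1)]) auto
  have "continuous_on UNIV (\<lambda>x. p x - q x)"
    by (intro continuous_on_diff assms)
  then show ?thesis
    using assms by (simp add: conv_continuous scaleR_diff_left integral_diff int)
qed

lemma conv_inner:
  fixes K :: "real^'n \<Rightarrow> 'b::euclidean_space"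
  assumes "continuous_on UNIV K" "continuous_on UNIV p"
  shows "conv (\<lambda>z. K z \<bullet> v) p x = conv K p x \<bullet> v"
proof -
  have "(\<lambda>y. p y *\<^sub>R K (x - y)) integrable_on cube"
    by (intro integrable_continuous continuous_intros continuous_on_subset[OF assms(2)]
        continuous_on_compose2[OF assms(1)]) auto
  from integral_linear[OF this bounded_linear_inner_left[of v]]
  have "integral cube (\<lambda>y. p y *\<^sub>R (K (x - y) \<bullet> v)) = integral cube (\<lambda>y. p y *\<^sub>R K (x - y)) \<bullet> v"
    by (simp add: o_def)
  moreover have "continuous_on UNIV (\<lambda>z. K z \<bullet> v)"
    by (intro continuous_on_inner assms continuous_on_const)
  ultimately show ?thesis
    by (simp only: conv_continuous[OF _ assms(2)] conv_continuous[OF assms])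
qed

text \<open>The equation in conservation form: the time derivative of the density is the divergence
  of this field (\<open>MV_flux_C1_divergence\<close>), so testing it against a function takes one
  integration by parts.\<close>

definition MV_flux ::
  "real \<Rightarrow> (real^'n \<Rightarrow> real) \<Rightarrow> (real^'n \<Rightarrow> real) \<Rightarrow> (real^'n \<Rightarrow> real) \<Rightarrow> real^'n \<Rightarrow> real^'n" where
  "MV_flux \<beta> V W p x = (p x *\<^sub>R grad V x + p x *\<^sub>R conv (grad W) p x) + (1 / \<beta>) *\<^sub>R grad p x"

lemma divergence_add_scaleR:
  assumes "C1_torus F F'" "C1_torus G G'"
  shows "divergence (\<lambda>x. F x + c *\<^sub>R G x) x = divergence F x + c * divergence G x"
proof -
  note F = C1_torus_has_derivative[OF assms(1), of x] and G = C1_torus_has_derivative[OF assms(2), of x]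
  have "((\<lambda>x. F x + c *\<^sub>R G x) has_derivative (\<lambda>v. F' x v + c *\<^sub>R G' x v)) (at x)"
    by (intro has_derivative_add has_derivative_scaleR_right F G)
  from divergence_eqI[OF this] show ?thesis
    by (simp add: divergence_eqI[OF F] divergence_eqI[OF G] sum.distrib sum_distrib_left)
qed

lemma MV_flux_C1_divergence:
  assumes "C2_torus V" "C2_torus W" "C2_torus p"
  obtains F' where "C1_torus (MV_flux \<beta> V W p) F'"
    and "\<And>x. divergence (MV_flux \<beta> V W p) x = MV_rhs \<beta> V W p x"
proof -
  note grad_C1 = C2_torus_C1_torus_grad
  note p = C2_torus_C1_torus[OF assms(3)]
  note conv = C1_torus_conv[OF grad_C1[OF assms(2)] C1_torus_continuous[OF p]]
  note drift = C1_torus_add[OF C1_torus_scaleR[OF p grad_C1[OF assms(1)]] C1_torus_scaleR[OF p conv]]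
  have eq: "MV_flux \<beta> V W p =
      (\<lambda>x. (p x *\<^sub>R grad V x + p x *\<^sub>R conv (grad W) p x) + (1 / \<beta>) *\<^sub>R grad p x)"
    by (rule ext) (rule MV_flux_def)
  have "divergence (MV_flux \<beta> V W p) x = MV_rhs \<beta> V W p x" for x
    unfolding eq
    by (simp add: divergence_add_scaleR[OF drift grad_C1[OF assms(3)]] MV_rhs_def laplacian_def)
  with C1_torus_add[OF drift C1_torus_linear[OF bounded_linear_scaleR_right[of "1 / \<beta>"] grad_C1[OF assms(3)]], folded eq]
  show thesis by (rule that)
qed

text \<open>
  With \<open>U = V + W * q\<close>, the flux of \<open>q\<close> is a positive multiple of the gradient of
  \<open>q exp (\<beta> U)\<close>; testing stationarity against \<open>q exp (\<beta> U)\<close> makes the flux vanish and forces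
  the Gibbs form.
\<close>

lemma stationary_density_le_Gamma:
  fixes V W q :: "real^'n \<Rightarrow> real"
  assumes \<beta>: "\<beta> > 0" and C2: "C2_torus V" "C2_torus W" "C2_torus q" and q: "prob_density q"
    and stationary: "\<And>x. MV_rhs \<beta> V W q x = 0" and x: "x \<in> cube"
  shows "q x \<le> Gamma_const \<beta> V W"
proof -
  note V_C1 = C2_torus_C1_torus[OF C2(1)] and W_C1 = C2_torus_C1_torus[OF C2(2)]
    and q_C1 = C2_torus_C1_torus[OF C2(3)] and gW_C1 = C2_torus_C1_torus_grad[OF C2(2)]
  note q_cont = C1_torus_continuous[OF q_C1]
  let ?J = "MV_flux \<beta> V W q"
  obtain J' where J: "C1_torus ?J J'" and div_J: "\<And>x. divergence ?J x = 0"
    using MV_flux_C1_divergence[OF C2] stationary by metis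
  define U where "U x = V x + conv W q x" for x
  define E where "E x = exp (\<beta> * U x)" for x
  define g where "g x = q x * E x" for x
  have q_nonneg: "0 \<le> q x" for x using q by (simp add: prob_density_def)
  have q_int: "integral cube q = 1" by (rule prob_density_integral[OF q q_cont])

  have U_C1: "C1_torus U (\<lambda>x v. (grad V x + conv (grad W) q x) \<bullet> v)"
    using C1_torus_add[OF V_C1 C1_torus_conv[OF W_C1 q_cont]]
    by (simp add: U_def[abs_def] conv_inner C1_torus_continuous[OF gW_C1] q_cont inner_add_left)
  have E_C1: "C1_torus E (\<lambda>x v. E x * (\<beta> * ((grad V x + conv (grad W) q x) \<bullet> v)))"
    using C1_torus_exp[OF C1_torus_linear[OF bounded_linear_mult_right U_C1]]
    unfolding E_def[abs_def] .
  have "C1_torus g (\<lambda>x v. q x * (E x * (\<beta> * ((grad V x + conv (grad W) q x) \<bullet> v))) + (grad q x \<bullet> v) * E x)"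
    using C1_torus_mult[OF q_C1 E_C1] unfolding g_def[abs_def] .
  also have "(\<lambda>x v. q x * (E x * (\<beta> * ((grad V x + conv (grad W) q x) \<bullet> v))) + (grad q x \<bullet> v) * E x)
      = (\<lambda>x v. (\<beta> * E x) * (?J x \<bullet> v))"
    using \<beta> by (simp add: MV_flux_def inner_add_left algebra_simps fun_eq_iff)
  finally have g_C1: "C1_torus g (\<lambda>x v. (\<beta> * E x) * (?J x \<bullet> v))" .
  have grad_g: "grad g x = (\<beta> * E x) *\<^sub>R ?J x" for x
    using grad_eqI[OF C1_torus_has_derivative[OF g_C1]] by (simp add: vec_eq_iff inner_axis)

  \<comment> \<open>The integrand is \<open>\<beta> * E x\<close> times the squared norm of the
    flux. Being continuous and nonnegative with integral zero, it vanishes at every point of the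
    cube, not just almost everywhere.\<close>
  have "integral cube (\<lambda>x. grad g x \<bullet> ?J x) = 0"
    using integral_divergence_by_parts[OF g_C1 J] by (simp add: div_J)
  moreover have "continuous_on cube (\<lambda>x. grad g x \<bullet> ?J x)"
    by (intro continuous_on_inner C1_torus_grad_continuous[OF g_C1] C1_torus_continuous[OF J])
  moreover have "0 \<le> grad g x \<bullet> ?J x" for x
    using \<beta> by (simp add: grad_g E_def)
  ultimately have "\<forall>x\<in>cube. grad g x \<bullet> ?J x = 0"
    using integral_cbox_eq_0_iff[OF _ box01_nonempty] by blast
  then have "\<forall>x\<in>cube. ?J x = 0"
    using \<beta> by (simp add: grad_g E_def)
  then have "(g has_derivative (\<lambda>v. 0)) (at x within cube)" if "x \<in> cube" for x
    using has_derivative_at_withinI[OF C1_torus_has_derivative[OF g_C1], of x cube] that by simp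
  then obtain c where c: "\<And>x. x \<in> cube \<Longrightarrow> g x = c"
    using has_derivative_zero_constant[OF convex_box(1), of 0 One g] by blast

  define M where "M = Linf_norm V + Linf_norm W"
  have U_le: "\<bar>U x\<bar> \<le> M" for x
  proof -
    have "norm (conv W q x) \<le> Linf_norm W * integral cube (\<lambda>y. \<bar>q y\<bar>)"
      by (intro conv_norm_le C1_torus_continuous[OF W_C1] q_cont norm_le_Linf_norm C1_torus_periodic[OF W_C1])
    moreover have "norm (V x) \<le> Linf_norm V"
      by (intro norm_le_Linf_norm C1_torus_continuous[OF V_C1] C1_torus_periodic[OF V_C1])
    ultimately show ?thesis
      using q_nonneg q_int by (simp add: U_def M_def)
  qed
  have q_eq: "q x = c * exp (- (\<beta> * U x))" if "x \<in> cube" for x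
    using c[OF that] by (auto simp: g_def E_def exp_minus field_simps)
  have c_nonneg: "0 \<le> c"
    using c[OF x] q_nonneg[of x] by (auto simp: g_def E_def)
  \<comment> \<open>\<Gamma> is a product of two factors exp (\<beta> M): unit mass and the lower
    bound on exp (- \<beta> U) give the first as a bound on the normalisation \<open>c\<close>, and
    the upper bound on exp (- \<beta> U) gives the second.\<close>
  have "integral cube (\<lambda>x :: real^'n. c * exp (- (\<beta> * M))) \<le> integral cube q"
  proof (rule integral_le)
    show "c * exp (- (\<beta> * M)) \<le> q y" if "y \<in> cube" for y
      unfolding q_eq[OF that] using \<beta> U_le[of y] c_nonneg
      by (intro mult_left_mono) (auto simp: abs_le_iff)
  qed (auto intro!: integrable_continuous q_cont)
  then have "c * exp (- (\<beta> * M)) \<le> 1"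
    by (simp add: q_int)
  then have c_le: "c \<le> exp (\<beta> * M)"
    by (simp add: exp_minus field_simps)
  have "\<beta> * - U x \<le> \<beta> * M"
    using \<beta> U_le[of x] by (intro mult_left_mono) auto
  then have "q x \<le> c * exp (\<beta> * M)"
    unfolding q_eq[OF x] using c_nonneg by (intro mult_left_mono) auto
  also have "\<dots> \<le> exp (\<beta> * M) * exp (\<beta> * M)"
    using c_le by (intro mult_right_mono) auto
  also have "\<dots> = Gamma_const \<beta> V W"
    by (simp add: Gamma_const_def M_def exp_add[symmetric] algebra_simps)
  finally show ?thesis .
qed

text \<open>For \<open>p = f r\<close> and a stationary \<open>q\<close> the left side is half the
  time derivative of the squared L^2 distance. Keeping the term of \<open>q\<close> lets a single
  integration by parts act on the difference \<open>?J\<close> of the two fluxes.\<close>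

lemma energy_dissipation:
  fixes V W p q :: "real^'n \<Rightarrow> real"
  assumes \<beta>: "\<beta> > 0" and C2: "C2_torus V" "C2_torus W" "C2_torus p" "C2_torus q"
    and dens: "prob_density p" "prob_density q"
    and q_le: "\<And>x. x \<in> cube \<Longrightarrow> q x \<le> Gamma_const \<beta> V W"
  shows "integral cube (\<lambda>x. (p x - q x) * (MV_rhs \<beta> V W p x - MV_rhs \<beta> V W q x))
           \<le> - zeta_rate \<beta> V W * integral cube (\<lambda>x. (p x - q x)\<^sup>2)"
proof -
  define A where "A = Linf_norm (grad V)"
  define B where "B = Linf_norm (grad W)"
  define \<Gamma> where "\<Gamma> = Gamma_const \<beta> V W"
  define h where "h x = p x - q x" for x
  define m where "m = integral cube (\<lambda>x. \<bar>h x\<bar>)"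
  define N where "N = integral cube (\<lambda>x. (h x)\<^sup>2)"
  define D where "D = integral cube (\<lambda>x. (norm (grad h x))\<^sup>2)"
  \<comment> \<open>Pointwise majorant of the drift difference \<open>R\<close>: a local part
    proportional to the size of \<open>h\<close>, and a constant in x that comes from the
    convolution with \<open>h\<close>.\<close>
  define a where "a x = (A + B) * \<bar>h x\<bar> + B * \<Gamma> * m" for x
  define R where "R x = h x *\<^sub>R grad V x + h x *\<^sub>R conv (grad W) p x + q x *\<^sub>R conv (grad W) h x" for x
  note gV_C1 = C2_torus_C1_torus_grad[OF C2(1)] and gW_C1 = C2_torus_C1_torus_grad[OF C2(2)]
    and p_C1 = C2_torus_C1_torus[OF C2(3)] and q_C1 = C2_torus_C1_torus[OF C2(4)]
  note p_cont = C1_torus_continuous[OF p_C1] and q_cont = C1_torus_continuous[OF q_C1]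
    and gW_cont = C1_torus_continuous[OF gW_C1]
  have h_C1: "C1_torus h (\<lambda>x v. grad p x \<bullet> v - grad q x \<bullet> v)"
    using C1_torus_diff[OF p_C1 q_C1] unfolding h_def[abs_def] .
  note h_cont = C1_torus_continuous[OF h_C1] and gh_cont = C1_torus_grad_continuous[OF h_C1]
  have grad_h: "grad h x = grad p x - grad q x" for x
    using grad_eqI[OF C1_torus_has_derivative[OF h_C1]] by (simp add: vec_eq_iff inner_axis)
  have p_nonneg: "0 \<le> p x" and q_nonneg: "0 \<le> q x" for x
    using dens by (simp_all add: prob_density_def)
  have p_int: "integral cube p = 1" and q_int: "integral cube q = 1"
    using dens by (simp_all add: prob_density_integral p_cont q_cont)
  have gV_le: "norm (grad V x) \<le> A" and gW_le: "norm (grad W x) \<le> B" for x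
    unfolding A_def B_def
    by (intro norm_le_Linf_norm C1_torus_continuous[OF gV_C1] C1_torus_continuous[OF gW_C1]
        C1_torus_periodic[OF gV_C1] C1_torus_periodic[OF gW_C1])+
  have A: "0 \<le> A" and B: "0 \<le> B" using gV_le gW_le order_trans[OF norm_ge_zero] by blast+
  have \<Gamma>: "0 \<le> \<Gamma>" by (simp add: \<Gamma>_def Gamma_const_def)
  have m_nonneg: "0 \<le> m" and N_nonneg: "0 \<le> N"
    unfolding m_def N_def by (intro integral_nonneg integrable_continuous continuous_intros h_cont; simp)+
  have m2: "m\<^sup>2 \<le> N"
    using integral_square_le[of 0 One "\<lambda>x. \<bar>h x\<bar>"] unfolding m_def N_def
    by (simp add: continuous_on_rabs h_cont)

  obtain F' where F: "C1_torus (MV_flux \<beta> V W p) F'"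
    and div_F: "\<And>x. divergence (MV_flux \<beta> V W p) x = MV_rhs \<beta> V W p x"
    using MV_flux_C1_divergence[OF C2(1,2,3)] by blast
  obtain G' where G: "C1_torus (MV_flux \<beta> V W q) G'"
    and div_G: "\<And>x. divergence (MV_flux \<beta> V W q) x = MV_rhs \<beta> V W q x"
    using MV_flux_C1_divergence[OF C2(1,2,4)] by blast
  let ?J = "\<lambda>x. MV_flux \<beta> V W p x + (-1) *\<^sub>R MV_flux \<beta> V W q x"
  note J = C1_torus_add[OF F C1_torus_linear[OF bounded_linear_scaleR_right G, of "-1"]]
  have div_J: "divergence ?J x = MV_rhs \<beta> V W p x - MV_rhs \<beta> V W q x" for x
    by (simp add: divergence_add_scaleR[OF F G, of "-1", simplified] div_F div_G)
  have J_eq: "?J x = R x + (1 / \<beta>) *\<^sub>R grad h x" for x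
  proof -
    have "conv (grad W) h x = conv (grad W) p x - conv (grad W) q x"
      unfolding h_def by (rule conv_diff[OF gW_cont p_cont q_cont])
    then have "conv (grad W) p x = conv (grad W) h x + conv (grad W) q x" by simp
    then show ?thesis
      by (simp add: R_def MV_flux_def grad_h h_def algebra_simps)
  qed
  have R_le: "norm (R x) \<le> a x" if "x \<in> cube" for x
  proof -
    have "norm (conv (grad W) p x) \<le> B * integral cube (\<lambda>y. \<bar>p y\<bar>)"
      by (rule conv_norm_le[OF gW_cont gW_le p_cont])
    then have convp: "norm (conv (grad W) p x) \<le> B" using p_nonneg p_int by simp
    have convh: "norm (conv (grad W) h x) \<le> B * m"
      unfolding m_def by (rule conv_norm_le[OF gW_cont gW_le h_cont])
    have "norm (R x) \<le> \<bar>h x\<bar> * norm (grad V x) + \<bar>h x\<bar> * norm (conv (grad W) p x)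
        + \<bar>q x\<bar> * norm (conv (grad W) h x)"
      unfolding R_def by (intro order_trans[OF norm_triangle_ineq] add_mono) auto
    also have "\<dots> \<le> \<bar>h x\<bar> * A + \<bar>h x\<bar> * B + \<Gamma> * (B * m)"
      using q_le[OF that] q_nonneg[of x] \<Gamma>
      by (intro add_mono mult_left_mono mult_mono gV_le convp convh) (auto simp: \<Gamma>_def)
    finally show ?thesis by (simp add: a_def algebra_simps)
  qed
  have young: "- (grad h x \<bullet> ?J x) \<le> (\<beta> / 2) * (a x)\<^sup>2 - (1 / (2 * \<beta>)) * (norm (grad h x))\<^sup>2"
    if "x \<in> cube" for x
  proof -
    let ?n = "norm (grad h x)"
    have "- (grad h x \<bullet> R x) \<le> ?n * norm (R x)"
      using norm_cauchy_schwarz[of "- grad h x" "R x"] by simp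
    also have "\<dots> \<le> ?n * a x" by (intro mult_left_mono R_le that) simp
    finally have "- (grad h x \<bullet> ?J x) \<le> ?n * a x - (1 / \<beta>) * ?n\<^sup>2"
      unfolding J_eq by (simp add: inner_add_right power2_norm_eq_inner)
    \<comment> \<open>Young's inequality as a completed square, weighted so that exactly half of the
      coefficient 1/\<beta> of the squared gradient is left.\<close>
    moreover have "0 \<le> (\<beta> / 2) * (a x - ?n / \<beta>)\<^sup>2" using \<beta> by simp
    moreover have "(\<beta> / 2) * (a x - ?n / \<beta>)\<^sup>2 = (\<beta> / 2) * (a x)\<^sup>2 - ?n * a x + (1 / (2 * \<beta>)) * ?n\<^sup>2"
      using \<beta> by (simp add: power2_eq_square field_simps)
    moreover have "(1 / \<beta>) * ?n\<^sup>2 = 2 * ((1 / (2 * \<beta>)) * ?n\<^sup>2)" using \<beta> by simp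
    ultimately show ?thesis by linarith
  qed
  have a_int: "integral cube (\<lambda>x. (a x)\<^sup>2) \<le> (A + (1 + \<Gamma>) * B)\<^sup>2 * N"
  proof -
    have "(\<lambda>x. (a x)\<^sup>2) = (\<lambda>x. (A + B)\<^sup>2 * (h x)\<^sup>2 + (2 * (A + B) * (B * \<Gamma> * m)) * \<bar>h x\<bar> + (B * \<Gamma> * m)\<^sup>2)"
      unfolding a_def power2_sum[of "(A + B) * _"] power_mult_distrib[of "A + B"] power2_abs
      by (simp add: mult_ac add_ac)
    moreover have "((\<lambda>x. (A + B)\<^sup>2 * (h x)\<^sup>2 + (2 * (A + B) * (B * \<Gamma> * m)) * \<bar>h x\<bar> + (B * \<Gamma> * m)\<^sup>2) has_integral
        ((A + B)\<^sup>2 * N + (2 * (A + B) * (B * \<Gamma> * m)) * m + measure lborel (cube :: (real^'n) set) *\<^sub>R (B * \<Gamma> * m)\<^sup>2)) cube"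
      unfolding N_def m_def
      by (intro has_integral_add has_integral_mult_right has_integral_const integrable_integral
          integrable_continuous continuous_on_power continuous_on_rabs h_cont)
    ultimately have "integral cube (\<lambda>x. (a x)\<^sup>2) =
        (A + B)\<^sup>2 * N + (2 * (A + B) * (B * \<Gamma> * m)) * m + (B * \<Gamma> * m)\<^sup>2"
      by (simp add: integral_unique)
    also have "\<dots> = (A + B)\<^sup>2 * N + (2 * (A + B) * (B * \<Gamma>) + (B * \<Gamma>)\<^sup>2) * m\<^sup>2"
      by (simp add: power2_eq_square algebra_simps)
    \<comment> \<open>The terms other than the leading one are nonnegative multiples of m^2.
      Replacing m^2 by N completes the square of A + B + B \<Gamma>, which is the bracket in
      \<zeta>.\<close>
    also have "\<dots> \<le> (A + B)\<^sup>2 * N + (2 * (A + B) * (B * \<Gamma>) + (B * \<Gamma>)\<^sup>2) * N"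
      using A B \<Gamma> by (intro add_left_mono mult_left_mono m2) auto
    also have "\<dots> = (A + (1 + \<Gamma>) * B)\<^sup>2 * N"
      by (simp add: power2_eq_square algebra_simps)
    finally show ?thesis .
  qed
  have "integral cube h = 0"
    using p_int q_int unfolding h_def[abs_def]
    by (subst integral_diff) (auto intro!: integrable_continuous p_cont q_cont)
  from poincare_torus[OF h_C1 this] have poincare: "8 * N \<le> D" by (simp add: N_def D_def)

  have "integral cube (\<lambda>x. h x * (MV_rhs \<beta> V W p x - MV_rhs \<beta> V W q x)) = integral cube (\<lambda>x. - (grad h x \<bullet> ?J x))"
    using integral_divergence_by_parts[OF h_C1 J] by (simp only: div_J integral_neg)
  also have "\<dots> \<le> integral cube (\<lambda>x. (\<beta> / 2) * (a x)\<^sup>2 - (1 / (2 * \<beta>)) * (norm (grad h x))\<^sup>2)"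
  proof (rule integral_le[OF _ _ young])
    show "(\<lambda>x. - (grad h x \<bullet> ?J x)) integrable_on cube"
      by (intro integrable_continuous continuous_on_minus continuous_on_inner gh_cont C1_torus_continuous[OF J])
    show "(\<lambda>x. \<beta> / 2 * (a x)\<^sup>2 - 1 / (2 * \<beta>) * (norm (grad h x))\<^sup>2) integrable_on cube"
      unfolding a_def by (intro integrable_continuous continuous_on_diff continuous_on_mult continuous_on_const
          continuous_on_power continuous_on_add continuous_on_rabs continuous_on_norm h_cont gh_cont)
  qed
  also have "\<dots> = (\<beta> / 2) * integral cube (\<lambda>x. (a x)\<^sup>2) - (1 / (2 * \<beta>)) * D"
    unfolding D_def a_def
    by (subst integral_diff) (simp_all only: integral_mult_right, (intro integrable_continuous
        continuous_on_mult continuous_on_const continuous_on_power continuous_on_add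
        continuous_on_rabs continuous_on_norm h_cont gh_cont)+)
  also have "\<dots> \<le> (\<beta> / 2) * ((A + (1 + \<Gamma>) * B)\<^sup>2 * N) - (1 / (2 * \<beta>)) * (8 * N)"
    using \<beta> by (intro diff_mono mult_left_mono a_int poincare) auto
  also have "\<dots> \<le> - zeta_rate \<beta> V W * N"
  proof -
    \<comment> \<open>Per unit of \<open>N\<close> the bound so far is
      \<open>?S / 2 - 4 / \<beta>\<close>, to be compared with the value \<open>?S\<close> - \<pi>^2
      / (4 \<beta>) of - \<zeta>. The first terms compare since \<open>?S\<close> is nonnegative,
      the second since \<pi> < 4.\<close>
    let ?S = "\<beta> * (A + (1 + \<Gamma>) * B)\<^sup>2"
    have "pi\<^sup>2 \<le> 4\<^sup>2" using pi_less_4 pi_gt_zero by (intro power_mono) auto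
    then have "pi\<^sup>2 / (4 * \<beta>) \<le> 16 / (4 * \<beta>)" using \<beta> by (intro divide_right_mono) auto
    moreover have "0 \<le> ?S" using \<beta> by simp
    ultimately have "?S / 2 - 4 / \<beta> \<le> - zeta_rate \<beta> V W"
      by (simp add: zeta_rate_def A_def B_def \<Gamma>_def)
    from mult_right_mono[OF this N_nonneg] show ?thesis
      by (simp add: algebra_simps)
  qed
  finally show ?thesis by (simp add: h_def N_def)
qed

subsection \<open>The time evolution of the distance\<close>

text \<open>Minkowski's inequality for exponent 2, obtained by bounding the mixed term through
  Cauchy-Schwarz. The norms \<open>a\<close> and \<open>b\<close> enter as real numbers through
  their squares, which avoids square roots of extended reals.\<close>

lemma nn_integral_square_triangle:
  assumes [measurable]: "u \<in> borel_measurable M" "v \<in> borel_measurable M"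
    and u: "(\<integral>\<^sup>+ x. ennreal ((u x)\<^sup>2) \<partial>M) = ennreal (a\<^sup>2)" and v: "(\<integral>\<^sup>+ x. ennreal ((v x)\<^sup>2) \<partial>M) = ennreal (b\<^sup>2)"
    and ab: "0 \<le> a" "0 \<le> b"
  shows "(\<integral>\<^sup>+ x. ennreal ((u x + v x)\<^sup>2) \<partial>M) \<le> ennreal ((a + b)\<^sup>2)"
proof -
  let ?C = "\<integral>\<^sup>+ x. ennreal \<bar>u x\<bar> * ennreal \<bar>v x\<bar> \<partial>M"
  have sq: "ennreal \<bar>r\<bar> ^ 2 = ennreal (r\<^sup>2)" for r
    by (simp add: ennreal_power)
  have "?C\<^sup>2 \<le> (\<integral>\<^sup>+ x. ennreal \<bar>u x\<bar> ^ 2 \<partial>M) * (\<integral>\<^sup>+ x. ennreal \<bar>v x\<bar> ^ 2 \<partial>M)"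
    by (rule Cauchy_Schwarz_nn_integral) auto
  also have "\<dots> = ennreal ((a * b)\<^sup>2)"
    by (simp add: sq u v ennreal_mult power_mult_distrib)
  finally have C2: "?C\<^sup>2 \<le> ennreal ((a * b)\<^sup>2)" .
  have C: "?C \<le> ennreal (a * b)"
  proof (cases ?C rule: ennreal_cases)
    case (real r)
    have "ennreal (r\<^sup>2) \<le> ennreal ((a * b)\<^sup>2)"
      using C2 unfolding real(2) ennreal_power[OF real(1)] .
    then have "r\<^sup>2 \<le> (a * b)\<^sup>2" by (subst (asm) ennreal_le_iff) (rule zero_le_power2)
    then have "r \<le> a * b" by (rule power2_le_imp_le) (rule mult_nonneg_nonneg[OF ab])
    then show ?thesis unfolding real(2) by (rule ennreal_leI)
  next
    case top
    have "ennreal ((a * b)\<^sup>2) = top"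
      using C2 unfolding top power2_eq_square[of "top :: ennreal"] by (simp only: ennreal_top_mult) (simp add: top_unique)
    then show ?thesis by (simp only: ennreal_neq_top)
  qed
  have "(\<integral>\<^sup>+ x. ennreal ((u x + v x)\<^sup>2) \<partial>M)
      \<le> (\<integral>\<^sup>+ x. ennreal ((u x)\<^sup>2) + ennreal ((v x)\<^sup>2) + 2 * (ennreal \<bar>u x\<bar> * ennreal \<bar>v x\<bar>) \<partial>M)"
  proof (rule nn_integral_mono)
    fix x
    have "(u x + v x)\<^sup>2 = (u x)\<^sup>2 + (v x)\<^sup>2 + 2 * (u x * v x)"
      by (simp add: power2_sum)
    also have "\<dots> \<le> (u x)\<^sup>2 + (v x)\<^sup>2 + 2 * (\<bar>u x\<bar> * \<bar>v x\<bar>)"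
      by (simp add: abs_mult[symmetric])
    finally have "ennreal ((u x + v x)\<^sup>2) \<le> ennreal ((u x)\<^sup>2 + (v x)\<^sup>2 + 2 * (\<bar>u x\<bar> * \<bar>v x\<bar>))"
      by (rule ennreal_leI)
    also have "\<dots> = ennreal ((u x)\<^sup>2) + ennreal ((v x)\<^sup>2) + 2 * (ennreal \<bar>u x\<bar> * ennreal \<bar>v x\<bar>)"
      by (simp add: ennreal_plus ennreal_mult)
    finally show "ennreal ((u x + v x)\<^sup>2) \<le> ennreal ((u x)\<^sup>2) + ennreal ((v x)\<^sup>2) + 2 * (ennreal \<bar>u x\<bar> * ennreal \<bar>v x\<bar>)" .
  qed
  also have "\<dots> = ennreal (a\<^sup>2) + ennreal (b\<^sup>2) + 2 * ?C"
    by (simp add: nn_integral_add nn_integral_cmult u v)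
  also have "\<dots> \<le> ennreal (a\<^sup>2) + ennreal (b\<^sup>2) + 2 * ennreal (a * b)"
    by (intro add_left_mono mult_left_mono C) auto
  also have "\<dots> = ennreal ((a + b)\<^sup>2)"
  proof -
    have "2 * ennreal (a * b) = ennreal (2 * (a * b))"
      using ab by (simp add: ennreal_mult)
    then show ?thesis
      using ab by (simp add: power2_sum ennreal_plus[symmetric] mult.assoc del: ennreal_plus)
  qed
  finally show ?thesis .
qed

section \<open>The L^2 norm as an extended real\<close>

lemma L2_norm_eqI:
  assumes "(\<integral>\<^sup>+ x. ennreal ((u x)\<^sup>2) \<partial>torus) = ennreal (a\<^sup>2)" "0 \<le> a"
  shows "L2_norm u = ennreal a"
  using assms by (simp add: L2_norm_def)

lemma L2_norm_cases:
  obtains "L2_norm u = \<infinity>"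
  | a where "0 \<le> a" "(\<integral>\<^sup>+ x. ennreal ((u x)\<^sup>2) \<partial>torus) = ennreal (a\<^sup>2)" "L2_norm u = ennreal a"
proof (cases "\<integral>\<^sup>+ x. ennreal ((u x)\<^sup>2) \<partial>torus")
  case (real r)
  then show ?thesis using that(2)[of "sqrt r"] by (simp add: L2_norm_eqI)
next
  case top
  then show ?thesis using that(1) by (simp add: L2_norm_def)
qed

lemma L2_norm_triangle:
  fixes u v :: "real^'n \<Rightarrow> real"
  assumes "u \<in> borel_measurable borel" "v \<in> borel_measurable borel"
  shows "L2_norm (\<lambda>x. u x + v x) \<le> L2_norm u + L2_norm v"
proof (cases u rule: L2_norm_cases)
  case u: (2 a)
  show ?thesis
  proof (cases v rule: L2_norm_cases)
    case v: (2 b)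
    from nn_integral_square_triangle[OF borel_measurable_torus borel_measurable_torus, OF assms u(2) v(2) u(1) v(1)]
    have le: "(\<integral>\<^sup>+ x. ennreal ((u x + v x)\<^sup>2) \<partial>torus) \<le> ennreal ((a + b)\<^sup>2)" .
    show ?thesis
    proof (cases "\<lambda>x. u x + v x" rule: L2_norm_cases)
      case 1
      then have "(\<integral>\<^sup>+ x. ennreal ((u x + v x)\<^sup>2) \<partial>torus) = \<infinity>"
        by (simp add: L2_norm_def Let_def split: if_splits)
      then show ?thesis using le by (simp add: top_unique)
    next
      case (2 c)
      then have "c \<le> a + b"
        using le u(1) v(1) by (auto intro: power2_le_imp_le)
      then show ?thesis
        using u v 2 by (simp add: ennreal_plus[symmetric] ennreal_leI del: ennreal_plus)
    qed
  qed simp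
qed simp

lemma L2_norm_continuous:
  fixes u :: "real^'n \<Rightarrow> real"
  assumes "continuous_on UNIV u"
  shows "L2_norm u = ennreal (sqrt (integral cube (\<lambda>x. (u x)\<^sup>2)))"
proof (rule L2_norm_eqI)
  have cont: "continuous_on cube (\<lambda>x. (u x)\<^sup>2)"
    using assms continuous_on_subset by (intro continuous_on_power) blast
  have nn: "0 \<le> integral cube (\<lambda>x. (u x)\<^sup>2)"
    by (intro integral_nonneg integrable_continuous cont) simp
  then show "(\<integral>\<^sup>+ x. ennreal ((u x)\<^sup>2) \<partial>torus) = ennreal ((sqrt (integral cube (\<lambda>x. (u x)\<^sup>2)))\<^sup>2)"
    using nn_integral_torus_continuous[OF cont] by simp
  show "0 \<le> sqrt (integral cube (\<lambda>x. (u x)\<^sup>2))" using nn by simp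
qed

text \<open>\<open>MV_solution\<close> provides joint continuity for the time derivative, while
  differentiating the energy under the integral requires it for \<open>f\<close> as well. Near a
  point the derivative is bounded on a compact neighbourhood, so \<open>f\<close> is Lipschitz in
  time uniformly in x; continuity in space at the single time \<open>t0\<close> then
  suffices.\<close>

lemma continuous_on_Pair_of_deriv:
  fixes f g :: "real \<Rightarrow> 'a::euclidean_space \<Rightarrow> real"
  assumes deriv: "\<And>t x. t > 0 \<Longrightarrow> ((\<lambda>s. f s x) has_real_derivative g t x) (at t)"
    and g: "continuous_on ({0<..} \<times> UNIV) (\<lambda>(t, x). g t x)"
    and f: "\<And>t. t > 0 \<Longrightarrow> continuous_on UNIV (f t)"
  shows "continuous_on ({0<..} \<times> UNIV) (\<lambda>(t, x). f t x)"
proof -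
  have "isCont (\<lambda>(t, x). f t x) (t0, x0)" if t0: "t0 > 0" for t0 x0
  proof -
    \<comment> \<open>The interval is a neighbourhood of \<open>t0\<close> that stays inside the
      positive times.\<close>
    let ?T = "{t0/2..2*t0}" and ?X = "cball x0 1"
    have "compact ((\<lambda>(t, x). g t x) ` (?T \<times> ?X))"
      using t0 by (intro compact_continuous_image continuous_on_subset[OF g] compact_Times) auto
    then obtain M where "\<forall>y\<in>(\<lambda>(t, x). g t x) ` (?T \<times> ?X). norm y \<le> M"
      by (auto dest!: compact_imp_bounded simp: bounded_iff)
    then have M: "norm (g t x) \<le> M" if "t \<in> ?T" "x \<in> ?X" for t x
      using that by auto
    have bound: "norm (f t x - f t0 x0) \<le> M * \<bar>t - t0\<bar> + \<bar>f t0 x - f t0 x0\<bar>"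
      if "t \<in> ?T" "x \<in> ?X" for t x
    proof -
      have "norm (f t x - f t0 x) \<le> M * norm (t - t0)"
      proof (rule field_differentiable_bound[of ?T])
        show "((\<lambda>s. f s x) has_field_derivative g s x) (at s within ?T)" if "s \<in> ?T" for s
          using that t0 by (auto intro: has_field_derivative_at_within[OF deriv])
      qed (use that t0 M in auto)
      then show ?thesis by simp
    qed
    have cf: "isCont (f t0) x0" using f[OF t0] by (simp add: continuous_on_eq_continuous_at)
    have f_snd: "((\<lambda>p. f t0 (snd p)) \<longlongrightarrow> f t0 x0) (at (t0, x0))"
      by (rule isCont_tendsto_compose[OF cf]) (auto intro!: tendsto_eq_intros)
    have fst: "(fst \<longlongrightarrow> t0) (at (t0, x0))"
      by (auto intro!: tendsto_eq_intros)
    have "((\<lambda>p. M * \<bar>fst p - t0\<bar> + \<bar>f t0 (snd p) - f t0 x0\<bar>) \<longlongrightarrow> M * \<bar>t0 - t0\<bar> + \<bar>f t0 x0 - f t0 x0\<bar>) (at (t0, x0))"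
      by (intro tendsto_intros f_snd fst)
    then have lim: "((\<lambda>p. M * \<bar>fst p - t0\<bar> + \<bar>f t0 (snd p) - f t0 x0\<bar>) \<longlongrightarrow> 0) (at (t0, x0))"
      by simp
    have "open ({t0/2<..<2*t0} \<times> ball x0 1)" "(t0, x0) \<in> {t0/2<..<2*t0} \<times> ball x0 1"
      using t0 by (auto intro: open_Times)
    then have "eventually (\<lambda>p. p \<in> {t0/2<..<2*t0} \<times> ball x0 1) (at (t0, x0))"
      by (rule eventually_at_in_open')
    then have "eventually (\<lambda>p. norm ((case p of (t, x) \<Rightarrow> f t x) - f t0 x0)
        \<le> M * \<bar>fst p - t0\<bar> + \<bar>f t0 (snd p) - f t0 x0\<bar>) (at (t0, x0))"
      by eventually_elim (use bound in auto)
    from Lim_null_comparison[OF this lim] show ?thesis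
      by (simp add: isCont_def LIM_zero_iff)
  qed
  then show ?thesis by (intro continuous_at_imp_continuous_on) auto
qed

lemma has_real_derivative_integral_square:
  fixes f g :: "real \<Rightarrow> real^'n \<Rightarrow> real"
  assumes deriv: "\<And>t x. t > 0 \<Longrightarrow> ((\<lambda>s. f s x) has_real_derivative g t x) (at t)"
    and g: "continuous_on ({0<..} \<times> UNIV) (\<lambda>(t, x). g t x)"
    and f: "\<And>t. t > 0 \<Longrightarrow> continuous_on UNIV (f t)"
    and t: "t > 0"
  shows "((\<lambda>t. integral cube (\<lambda>x. (f t x)\<^sup>2)) has_real_derivative
           2 * integral cube (\<lambda>x. f t x * g t x)) (at t)"
proof -
  have g': "continuous_on ({0<..} \<times> cube) (\<lambda>p. g (fst p) (snd p))"
    using g by (auto simp: case_prod_unfold intro: continuous_on_subset)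
  have f': "continuous_on ({0<..} \<times> cube) (\<lambda>p. f (fst p) (snd p))"
    using continuous_on_Pair_of_deriv[OF deriv g f] by (auto simp: case_prod_unfold intro: continuous_on_subset)
  have "((\<lambda>t. integral cube (\<lambda>x. (f t x)\<^sup>2)) has_field_derivative
      integral cube (\<lambda>x. 2 * (f t x * g t x))) (at t within {0<..})"
  proof (rule leibniz_rule_field_derivative)
    show "((\<lambda>s. (f s x)\<^sup>2) has_field_derivative 2 * (f s x * g s x)) (at s within {0<..})" if "s \<in> {0<..}" for s x
      using that by (auto intro!: derivative_eq_intros has_field_derivative_at_within[OF deriv])
    show "(\<lambda>x. (f s x)\<^sup>2) integrable_on cube" if "s \<in> {0<..}" for s
      using that by (intro integrable_cbox_continuous_UNIV continuous_on_power f) simp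
    show "continuous_on ({0<..} \<times> cube) (\<lambda>(s, x). 2 * (f s x * g s x))"
      unfolding case_prod_unfold by (intro continuous_on_mult continuous_on_const f' g')
  qed (use t in auto)
  then show ?thesis
    using t by (simp add: at_within_open[OF _ open_greaterThan])
qed

text \<open>Gronwall's inequality by the integrating factor exp (c r). The constant \<open>c\<close>
  may have either sign, as \<open>zeta_rate\<close> may.\<close>

lemma exponential_decay_of_deriv:
  fixes E E' :: "real \<Rightarrow> real"
  assumes deriv: "\<And>r. s \<le> r \<Longrightarrow> (E has_real_derivative E' r) (at r)"
    and le: "\<And>r. s \<le> r \<Longrightarrow> E' r \<le> - c * E r" and "s \<le> t"
  shows "E t \<le> E s * exp (- c * (t - s))"
proof -
  have "E t * exp (c * t) \<le> E s * exp (c * s)"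
  proof (rule DERIV_nonpos_imp_nonincreasing[OF \<open>s \<le> t\<close>])
    fix r assume r: "s \<le> r" "r \<le> t"
    have "((\<lambda>r. E r * exp (c * r)) has_real_derivative (E' r + c * E r) * exp (c * r)) (at r)"
      by (rule derivative_eq_intros deriv r refl)+ (simp add: algebra_simps)
    moreover have "(E' r + c * E r) * exp (c * r) \<le> 0"
      using le[OF r(1)] by (intro mult_nonpos_nonneg) auto
    ultimately show "\<exists>y. ((\<lambda>r. E r * exp (c * r)) has_real_derivative y) (at r) \<and> y \<le> 0" by blast
  qed
  then have "E t * exp (c * t) * exp (- c * t) \<le> E s * exp (c * s) * exp (- c * t)"
    by (rule mult_right_mono) simp
  then show ?thesis
    by (simp add: mult.assoc exp_add[symmetric] algebra_simps)
qed

section \<open>Decay of the solution\<close>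

lemma MV_solutionD:
  assumes "MV_solution \<beta> V W f0 f"
  shows "f 0 = f0"
    and "t \<ge> 0 \<Longrightarrow> prob_density (f t)"
    and "t > 0 \<Longrightarrow> C2_torus (f t)"
    and "t > 0 \<Longrightarrow> ((\<lambda>s. f s x) has_real_derivative MV_rhs \<beta> V W (f t) x) (at t)"
  using assms by (simp_all add: MV_solution_def)

lemma L2_decay_positive_times:
  fixes V W f0 f_inf :: "real^'n \<Rightarrow> real"
  assumes \<beta>: "\<beta> > 0" and V: "C2_torus V" and W: "C2_torus W"
    and sol: "MV_solution \<beta> V W f0 f" and inv: "invariant_density \<beta> V W f_inf"
    and st: "0 < s" "s \<le> t"
  shows "L2_norm (\<lambda>x. f t x - f_inf x)
    \<le> L2_norm (\<lambda>x. f s x - f_inf x) * ennreal (exp (- zeta_rate \<beta> V W * (t - s)))"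
proof -
  let ?q = "f_inf" and ?z = "zeta_rate \<beta> V W"
  define E where "E r = integral cube (\<lambda>x. (f r x - ?q x)\<^sup>2)" for r
  note inv' = inv[unfolded invariant_density_def]
  \<comment> \<open>Time 1 stands for any positive time. There the constant path has derivative 0,
    and by the equation also derivative \<open>MV_rhs\<close>, which makes \<open>f_inf\<close>
    stationary.\<close>
  have q_C2: "C2_torus ?q" and q_dens: "prob_density ?q"
    and q_deriv: "((\<lambda>s. ?q x) has_real_derivative MV_rhs \<beta> V W ?q x) (at 1)" for x
    using MV_solutionD(2-4)[OF inv', of 1] by simp_all
  have stationary: "MV_rhs \<beta> V W ?q x = 0" for x
    using DERIV_unique[OF q_deriv DERIV_const] .
  note q_cont = C1_torus_continuous[OF C2_torus_C1_torus[OF q_C2]]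
  have f_C2: "C2_torus (f r)" and f_dens: "prob_density (f r)"
    and f_deriv: "((\<lambda>s. f s x) has_real_derivative MV_rhs \<beta> V W (f r) x) (at r)" if "r > 0" for r x
    using MV_solutionD(2-4)[OF sol, of r] that by simp_all
  note f_cont = C1_torus_continuous[OF C2_torus_C1_torus[OF f_C2]]
  have rhs_cont: "continuous_on ({0<..} \<times> UNIV) (\<lambda>(r, x). MV_rhs \<beta> V W (f r) x)"
  proof -
    have "continuous_on ({0<..} \<times> UNIV) (\<lambda>(r, x). deriv (\<lambda>s. f s x) r)"
      using sol by (simp add: MV_solution_def)
    then show ?thesis
      by (rule continuous_on_eq) (auto intro: DERIV_imp_deriv f_deriv)
  qed
  have E_deriv: "(E has_real_derivative 2 * integral cube (\<lambda>x. (f r x - ?q x) * MV_rhs \<beta> V W (f r) x)) (at r)"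
    if "r > 0" for r
    unfolding E_def[abs_def]
  proof (rule has_real_derivative_integral_square[OF _ rhs_cont _ that])
    show "((\<lambda>s. f s x - ?q x) has_real_derivative MV_rhs \<beta> V W (f r) x) (at r)" if "r > 0" for r x
      using DERIV_diff[OF f_deriv[OF that] DERIV_const] by simp
    show "continuous_on UNIV (\<lambda>x. f r x - ?q x)" if "r > 0" for r
      by (intro continuous_on_diff f_cont[OF that] q_cont)
  qed
  \<comment> \<open>\<open>E\<close> is the squared distance, so it decays at twice the rate; the
    square root below restores \<zeta>.\<close>
  have "E t \<le> E s * exp (- (2 * ?z) * (t - s))"
  proof (rule exponential_decay_of_deriv[OF E_deriv _ \<open>s \<le> t\<close>])
    show "2 * integral cube (\<lambda>x. (f r x - ?q x) * MV_rhs \<beta> V W (f r) x) \<le> - (2 * ?z) * E r" if "s \<le> r" for r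
    proof -
      have "r > 0" using that st by simp
      from energy_dissipation[OF \<beta> V W f_C2[OF this] q_C2 f_dens[OF this] q_dens
          stationary_density_le_Gamma[OF \<beta> V W q_C2 q_dens stationary]]
      show ?thesis by (simp add: stationary E_def)
    qed
  qed (use st in auto)
  also have "\<dots> = E s * (exp (- ?z * (t - s)))\<^sup>2"
    by (simp add: power2_eq_square exp_add[symmetric] algebra_simps)
  finally have "sqrt (E t) \<le> sqrt (E s * (exp (- ?z * (t - s)))\<^sup>2)"
    by (rule real_sqrt_le_mono)
  then have "sqrt (E t) \<le> sqrt (E s) * exp (- ?z * (t - s))"
    by (simp add: real_sqrt_mult)
  then have "ennreal (sqrt (E t)) \<le> ennreal (sqrt (E s)) * ennreal (exp (- ?z * (t - s)))"
    by (simp add: ennreal_mult'' [symmetric] ennreal_leI)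
  moreover have "L2_norm (\<lambda>x. f r x - ?q x) = ennreal (sqrt (E r))" if "r > 0" for r
    unfolding E_def by (intro L2_norm_continuous continuous_on_diff f_cont[OF that] q_cont)
  ultimately show ?thesis using st by simp
qed

theorem proposition2p14:
  fixes \<beta> :: real
    and V W f0 f_inf :: "real^'n \<Rightarrow> real"
    and f :: "real \<Rightarrow> real^'n \<Rightarrow> real"
  assumes "\<beta> > 0"
    and "C2_torus V" and "C2_torus W"
    and "\<forall>x. W (- x) = W x"
    and "H_stable W \<or> Linf_norm W < 1 / \<beta>"
    and "prob_density f0"
    and "MV_solution \<beta> V W f0 f"
    and "invariant_density \<beta> V W f_inf"
  shows "\<forall>t\<ge>0. L2_norm (\<lambda>x. f t x - f_inf x)
           \<le> L2_norm (\<lambda>x. f0 x - f_inf x) * ennreal (exp (- zeta_rate \<beta> V W * t))"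
proof (intro allI impI)
  fix t :: real assume "t \<ge> 0"
  let ?z = "zeta_rate \<beta> V W" and ?N = "L2_norm (\<lambda>x. f0 x - f_inf x)"
  note sol = MV_solutionD[OF assms(7)]
    and inv = MV_solutionD(2,3)[OF assms(8)[unfolded invariant_density_def], of 1, simplified]
  have f_meas: "f s \<in> borel_measurable borel" if "s \<ge> 0" for s
    using sol(2)[OF that] by (simp add: prob_density_def)
  have f0_meas: "f0 \<in> borel_measurable borel" and q_meas: "f_inf \<in> borel_measurable borel"
    using assms(6) inv(1) by (simp_all add: prob_density_def)
  have "C2_torus f_inf" by (rule inv(2))
  note q_cont = C1_torus_continuous[OF C2_torus_C1_torus[OF this]]
  \<comment> \<open>For t = 0 both sides agree. If the initial distance is infinite then so is the
    right side, the exponential being positive. Only a finite distance calls for the limit at time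
    0.\<close>
  consider "t = 0" | "t > 0" "?N = \<infinity>" | "t > 0" "?N < \<infinity>"
    using \<open>t \<ge> 0\<close> by (cases "t = 0"; cases "?N = \<infinity>") (auto simp: less_top)
  then show "L2_norm (\<lambda>x. f t x - f_inf x) \<le> ?N * ennreal (exp (- ?z * t))"
  proof cases
    case 1
    then show ?thesis by (simp add: sol(1))
  next
    case 2
    then show ?thesis by (simp add: ennreal_top_mult)
  next
    case 3
    \<comment> \<open>Since \<open>f_inf\<close> is continuous, a finite distance to it makes
      \<open>f0\<close> square integrable. This is the premise under which
      \<open>MV_solution\<close> yields attainment of the initial density in L^2.\<close>
    have "L2_norm (\<lambda>x. (f0 x - f_inf x) + f_inf x) \<le> ?N + L2_norm f_inf"
      by (intro L2_norm_triangle borel_measurable_diff f0_meas q_meas)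
    also have "\<dots> < \<infinity>"
      using 3 by (simp add: L2_norm_continuous[OF q_cont])
    finally have "((\<lambda>s. L2_norm (\<lambda>x. f s x - f0 x)) \<longlongrightarrow> 0) (at_right 0)"
      using assms(7) by (simp add: MV_solution_def)
    moreover have "((\<lambda>s. ennreal (exp (- ?z * (t - s)))) \<longlongrightarrow> ennreal (exp (- ?z * (t - 0)))) (at_right 0)"
      by (intro tendsto_intros)
    ultimately have "((\<lambda>s. (L2_norm (\<lambda>x. f s x - f0 x) + ?N) * ennreal (exp (- ?z * (t - s))))
        \<longlongrightarrow> (0 + ?N) * ennreal (exp (- ?z * (t - 0)))) (at_right 0)"
      using 3 by (intro tendsto_mult_ennreal tendsto_add tendsto_const) auto
    \<comment> \<open>The decay is started at a small time \<open>s\<close>, and the distance at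
      \<open>s\<close> is bounded by the initial distance plus the L^2 error at \<open>s\<close>.
      The left side does not depend on \<open>s\<close>, so the bound survives the limit.\<close>
    moreover have "eventually (\<lambda>s. L2_norm (\<lambda>x. f t x - f_inf x)
        \<le> (L2_norm (\<lambda>x. f s x - f0 x) + ?N) * ennreal (exp (- ?z * (t - s)))) (at_right 0)"
      using eventually_at_right_less[of 0] eventually_at_right_real[OF 3(1)]
    proof eventually_elim
      case (elim s)
      then have s: "0 < s" "s \<le> t" by auto
      have "L2_norm (\<lambda>x. (f s x - f0 x) + (f0 x - f_inf x)) \<le> L2_norm (\<lambda>x. f s x - f0 x) + ?N"
        using s by (intro L2_norm_triangle borel_measurable_diff f_meas f0_meas q_meas) auto
      then have "L2_norm (\<lambda>x. f s x - f_inf x) \<le> L2_norm (\<lambda>x. f s x - f0 x) + ?N"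
        by simp
      from order_trans[OF L2_decay_positive_times[OF assms(1-3,7,8) s] mult_right_mono[OF this]]
      show ?case by simp
    qed
    ultimately show ?thesis
      using tendsto_lowerbound[of _ _ "at_right (0::real)"] by fastforce
  qed
qed

end
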